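(* Let $(G,q_1,\theta_1)$, $(\Gamma,q_2,\theta_2)$, $U=\{0,u_0\}$, $q_0$, $K_*$, $\Sigma_*$, $s$, $f$, $J$, $S$, $T$ be as in the context (including conditions (1)–(5) there). Then for all $m\in\mathbb{N}$, $u\in U$, $k\in K_*$, $\sigma\in\Sigma_*$, $\varepsilon\in\{1,-1\}$, $g\in G_*$, $\gamma\in\Gamma_*$: $$\nu_m((u,0))=\delta_{mu,0}\,q_0(u)^m,$$ $$\nu_m((u,\pi))=\tfrac14\sum_{v\in U}\langle u,v\rangle|\mathcal{G}(q_1,q_2,v,m)|^2,$$ $$\nu_m((k,\varepsilon))=\tfrac18\sum_{v\in U}\langle k,v\rangle|\mathcal{G}(q_1,q_2,v,m)|^2+\tfrac12\delta_{mk,0}\,q_1(k)^m,$$ $$\nu_m(g)=\tfrac14\sum_{v\in U}\langle g,v\rangle|\mathcal{G}(q_1,q_2,v,m)|^2+\delta_{mg,0}\,q_1(g)^m,$$ $$\nu_m((\sigma,\varepsilon))=\tfrac18\sum_{v\in U}\langle\sigma,v\rangle|\mathcal{G}(q_1,q_2,v,m)|^2-\tfrac12\delta_{m\sigma,0}\,q_2(\sigma)^m,$$ $$\nu_m(\gamma)=\tfrac14\sum_{v\in U}\langle\gamma,v\rangle|\mathcal{G}(q_1,q_2,v,m)|^2-\delta_{m\gamma,0}\,q_2(\gamma)^m,$$ where $$\mathcal{G}(q_1,q_2,v,m)=\frac{1}{\sqrt{|G|}}\sum_{g\in G}\langle v,g\rangle q_1(g)^m+\frac{1}{\sqrt{|\Gamma|}}\sum_{\gamma\in\Gamma}\langle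 v,\gamma\rangle q_2(\gamma)^m.$$ In particular, the condition (FS2), that for every $x\in J$ one has $\nu_2(x)=0$ if $x\ne\overline x$ and $\nu_2(x)\in\{1,-1\}$ if $x=\overline x$, implies $$|\mathcal{G}(q_1,q_2,0,2)|^2+|\mathcal{G}(q_1,q_2,u_0,2)|^2=4.$$
   Context: A metric group $(G,q)$ is a finite abelian group $G$ with a map $q:G\to\mathbb{T}=\{z\in\mathbb{C}:|z|=1\}$ such that $q(-g)=q(g)$ and $\langle g,h\rangle=q(g+h)q(g)^{-1}q(h)^{-1}$ is a non-degenerate bicharacter. $\mathcal{G}(q)=\frac{1}{\sqrt{|G|}}\sum_{g\in G}q(g)$. An involutive metric group $(G,q,\theta)$ is a metric group with $\theta\in\mathrm{Aut}(G)$, $\theta^2=\mathrm{id}$, $q\circ\theta=q$; $G^\theta$ is the fixed-point subgroup. Subscripts on $\langle\cdot,\cdot\rangle$ and $\theta$ are suppressed. Setting: $(G,q_1,\theta_1)$, $(\Gamma,q_2,\theta_2)$ are involutive metric groups with $c:=\mathcal{G}(q_1)=-\mathcal{G}(q_2)$ and $|G^{\theta_1}|=|\Gamma^{\theta_2}|=4$; $k_0\in G^{\theta_1}$ and $\sigma_0\in\Gamma^{\theta_2}$ are elements of order 2 with $q_1(k_0)=q_2(\sigma_0)$. Identify $\{0,k_0\}$ and $\{0,\sigma_0\}$ and denote both by $U=\{0,u_0\}$, a common subgroup of $G^{\theta_1}$ and $\Gamma^{\theta_2}$; $q_0$ is the restriction of $q_1$ (equivalently $q_2$) to $U$. (A pairing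 of an element of $U$ with an element of $G$, resp. $\Gamma$, is computed in $G$, resp. $\Gamma$.) Write $K_*=G^{\theta_1}\setminus\{0,k_0\}=\{k_1,k_2\}$, $\Sigma_*=\Gamma^{\theta_2}\setminus\{0,\sigma_0\}=\{\sigma_1,\sigma_2\}$. Assume one of: (A1) $q_1(k_1)=q_1(k_2)$, $q_2(\sigma_1)=-q_2(\sigma_2)$, and $s:=c/q_1(k_1)$ satisfies $s^4=1$; (A2) $q_1(k_1)=-q_1(k_2)$, $q_2(\sigma_1)=q_2(\sigma_2)$, and $s:=c/q_2(\sigma_1)$ satisfies $s^4=1$. Assume moreover: (1) $|\Gamma|=|G|+4$; (2) $(1+\langle u_0,k\rangle)(1-s^2\langle k,k\rangle)=0$ for all $k\in K_*$; (3) $(1+\langle u_0,\sigma\rangle)(1+s^2\langle\sigma,\sigma\rangle)=0$ for all $\sigma\in\Sigma_*$; (4) if $G^{\theta_1}\cong\mathbb{Z}_4$ then $q_0(u_0)=-1$; (5) if $\Gamma^{\theta_2}\cong\mathbb{Z}_4$ then $q_0(u_0)=-1$. Put $a=1/\sqrt{|G|}$, $b=1/\sqrt{|\Gamma|}$; fix $G_*\subset G$, $\Gamma_*\subset\Gamma$ with $G=G^{\theta_1}\sqcup G_*\sqcup\theta_1(G_* )$, $\Gamma=\Gamma^{\theta_2}\sqcup\Gamma_*\sqcup\theta_2(\Gamma_* )$. Let $J_1=K_*\times\{1,-1\}$, $J_2=\Sigma_*\times\{1,-1\}$, $J=(U\times\{0,\pi\})\sqcup J_1\sqcup G_*\sqcup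 J_2\sqcup\Gamma_*$. Fix $f:K_*\times\Sigma_*\to\{s,-s\}$ with $f(k+k_0,\sigma)=f(k,\sigma)\overline{\langle u_0,\sigma\rangle}$ and $f(k,\sigma+\sigma_0)=f(k,\sigma)\overline{\langle k,u_0\rangle}$. Involution on $J$: $(u,0)$ and $(u,\pi)$ are fixed, $\overline{(k,\varepsilon)}=(-k,s^2\varepsilon)$, $\overline{(\sigma,\varepsilon)}=(-\sigma,s^2\varepsilon)$, $\overline g=-g$ if $-g\in G_*$ and $\theta_1(-g)$ otherwise, $\overline\gamma=-\gamma$ if $-\gamma\in\Gamma_*$ and $\theta_2(-\gamma)$ otherwise. With blocks indexed in order by $U\times\{0\},U\times\{\pi\},J_1,G_*,J_2,\Gamma_*$ (rows $u,u,(k,\varepsilon),g,(\sigma,\varepsilon),\gamma$; columns with primes): $$S=\begin{pmatrix} \frac{a-b}{2}\overline{\langle u,u'\rangle}&\frac{a+b}{2}\overline{\langle u,u'\rangle}&\frac{a}{2}\overline{\langle u,k'\rangle}&a\overline{\langle u,g'\rangle}&\frac{b}{2}\overline{\langle u,\sigma'\rangle}&b\overline{\langle u,\gamma'\rangle}\\ \frac{a+b}{2}\overline{\langle u,u'\rangle}&\frac{a-b}{2}\overline{\langle u,u'\rangle}&\frac{a}{2}\overline{\langle u,k'\rangle}&a\overline{\langle u,g'\rangle}&-\frac{b}{2}\overline{\langle u,\sigma'\rangle}&-b\overline{\langle u,\gamma'\rangle}\\ \frac{a}{2}\overline{\langle k,u'\rangle}&\frac{a}{2}\overline{\langle k,u'\rangle}&(\frac{a}{2}+\frac{\varepsilon\varepsilon's}{4})\overline{\langle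 k,k'\rangle}&a\overline{\langle k,g'\rangle}&\frac{\varepsilon\varepsilon'f(k,\sigma')}{4}&0\\ a\overline{\langle g,u'\rangle}&a\overline{\langle g,u'\rangle}&a\overline{\langle g,k'\rangle}&a(\overline{\langle g,g'\rangle}+\overline{\langle g,\theta(g')\rangle})&0&0\\ \frac{b}{2}\overline{\langle\sigma,u'\rangle}&-\frac{b}{2}\overline{\langle\sigma,u'\rangle}&\frac{\varepsilon\varepsilon'f(k',\sigma)}{4}&0&-(\frac{b}{2}-\frac{\varepsilon\varepsilon's}{4})\overline{\langle\sigma,\sigma'\rangle}&-b\overline{\langle\sigma,\gamma'\rangle}\\ b\overline{\langle\gamma,u'\rangle}&-b\overline{\langle\gamma,u'\rangle}&0&0&-b\overline{\langle\gamma,\sigma'\rangle}&-b(\overline{\langle\gamma,\gamma'\rangle}+\overline{\langle\gamma,\theta(\gamma')\rangle}) \end{pmatrix},$$ $T=\mathrm{Diag}(q_0(u),q_0(u),q_1(k),q_1(g),q_2(\sigma),q_2(\gamma))$. Write $0=(0,0)\in J$. $N_{x,y,z}=\sum_{w\in J}S_{w,x}S_{w,y}S_{w,z}/S_{0,w}$, $N_{x,y}^z=N_{x,y,\overline z}$, and $\nu_m(z)=\sum_{x,y\in J}N_{x,y}^z\,S_{0,x}S_{0,y}(T_{y,y}/T_{x,x})^m$. *)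

theory Defs
  imports "HOL-Analysis.Analysis" "HOL-Library.Numeral_Type"
begin

definition pairing :: "('a::ab_group_add \<Rightarrow> complex) \<Rightarrow> 'a \<Rightarrow> 'a \<Rightarrow> complex" where
  "pairing q g h = q (g + h) * inverse (q g) * inverse (q h)"

text \<open>The group is the whole type. The pairing is symmetric by its definition, so non-degeneracy
  in one variable suffices.\<close>

locale metric_group =
  fixes q :: "'a::{ab_group_add,finite} \<Rightarrow> complex"
  assumes norm_q: "cmod (q g) = 1"
    and q_minus: "q (- g) = q g"
    and pairing_add_left: "pairing q (g + g') h = pairing q g h * pairing q g' h"
    and pairing_add_right: "pairing q g (h + h') = pairing q g h * pairing q g h'"
    and nondegenerate: "(\<And>h. pairing q g h = 1) \<Longrightarrow> g = 0"

locale involutive_metric_group = metric_group q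
  for q :: "'a::{ab_group_add,finite} \<Rightarrow> complex" +
  fixes \<theta> :: "'a \<Rightarrow> 'a"
  assumes theta_bij: "bij \<theta>"
    and theta_add: "\<theta> (g + h) = \<theta> g + \<theta> h"
    and theta_theta: "\<theta> (\<theta> g) = g"
    and q_theta: "q (\<theta> g) = q g"

definition gauss_sum :: "('a::{ab_group_add,finite} \<Rightarrow> complex) \<Rightarrow> complex" where
  "gauss_sum q = complex_of_real (1 / sqrt (real CARD('a))) * (\<Sum>g\<in>UNIV. q g)"

definition fixed_points :: "('a \<Rightarrow> 'a) \<Rightarrow> 'a set" where
  "fixed_points \<theta> = {g. \<theta> g = g}"

text \<open>The numeral type \<^typ>\<open>4\<close> is the ring of integers modulo 4.\<close>

definition iso_Z4 :: "'a::ab_group_add set \<Rightarrow> bool" where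
  "iso_Z4 A \<longleftrightarrow> (\<exists>\<phi> :: 'a \<Rightarrow> 4. bij_betw \<phi> A UNIV \<and>
     (\<forall>x\<in>A. \<forall>y\<in>A. \<phi> (x + y) = \<phi> x + \<phi> y))"

definition nmult :: "nat \<Rightarrow> 'a::ab_group_add \<Rightarrow> 'a" where
  "nmult m x = ((+) x ^^ m) 0"

definition star_part :: "('a::ab_group_add \<Rightarrow> 'a) \<Rightarrow> 'a \<Rightarrow> 'a set" where
  "star_part \<theta> k\<^sub>0 = fixed_points \<theta> - {0, k\<^sub>0}"

definition orbit_representatives :: "('a \<Rightarrow> 'a) \<Rightarrow> 'a set \<Rightarrow> bool" where
  "orbit_representatives \<theta> R \<longleftrightarrow>
     fixed_points \<theta> \<union> R \<union> \<theta> ` R = UNIV \<and>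
     fixed_points \<theta> \<inter> R = {} \<and> fixed_points \<theta> \<inter> \<theta> ` R = {} \<and> R \<inter> \<theta> ` R = {}"

text \<open>The common subgroup $U$, obtained by identifying $\{0,k_0\}$ with $\{0,\sigma_0\}$, is the graph of
  that identification inside the product group: \<^const>\<open>fst\<close> and \<^const>\<open>snd\<close> are the two embeddings.
  Hence $u_0$ is $(k_0,\sigma_0)$, and an element $u$ of $U$ is paired with elements of the first group
  through \<open>fst u\<close> and with elements of the second group through \<open>snd u\<close>.\<close>

definition common_subgroup ::
    "'a::ab_group_add \<Rightarrow> 'b::ab_group_add \<Rightarrow> ('a \<times> 'b) set" where
  "common_subgroup k\<^sub>0 \<sigma>\<^sub>0 = {(0, 0), (k\<^sub>0, \<sigma>\<^sub>0)}"

definition q\<^sub>0 :: "('a \<Rightarrow> complex) \<Rightarrow> 'a \<times> 'b \<Rightarrow> complex" where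
  "q\<^sub>0 q\<^sub>1 u = q\<^sub>1 (fst u)"

text \<open>Labels: \<open>L0 u\<close> is $(u,0)$, \<open>Lpi u\<close> is $(u,\pi)$, \<open>LK k \<epsilon>\<close> is $(k,\varepsilon)$ and
  \<open>LSigma \<sigma> \<epsilon>\<close> is $(\sigma,\varepsilon)$. The signs are complex numbers because the involution multiplies
  them by $s^2$. The sets \<open>Gs\<close> and \<open>\<Gamma>s\<close> are $G_*$ and $\Gamma_*$; $K_*$ and $\Sigma_*$ are values of
  \<^const>\<open>star_part\<close>.\<close>

datatype ('a, 'b) label =
    L0 "'a \<times> 'b" | Lpi "'a \<times> 'b" | LK 'a complex | LG 'a | LSigma 'b complex | LGamma 'b

definition labels :: "('a::ab_group_add \<Rightarrow> 'a) \<Rightarrow> ('b::ab_group_add \<Rightarrow> 'b) \<Rightarrow> 'a \<Rightarrow> 'b \<Rightarrow>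
    'a set \<Rightarrow> 'b set \<Rightarrow> ('a, 'b) label set" where
  "labels \<theta>\<^sub>1 \<theta>\<^sub>2 k\<^sub>0 \<sigma>\<^sub>0 Gs \<Gamma>s =
     L0 ` common_subgroup k\<^sub>0 \<sigma>\<^sub>0 \<union> Lpi ` common_subgroup k\<^sub>0 \<sigma>\<^sub>0 \<union>
     {LK k \<epsilon> | k \<epsilon>. k \<in> star_part \<theta>\<^sub>1 k\<^sub>0 \<and> \<epsilon> \<in> {1, -1}} \<union> LG ` Gs \<union>
     {LSigma \<sigma> \<epsilon> | \<sigma> \<epsilon>. \<sigma> \<in> star_part \<theta>\<^sub>2 \<sigma>\<^sub>0 \<and> \<epsilon> \<in> {1, -1}} \<union> LGamma ` \<Gamma>s"

fun dual :: "('a::ab_group_add \<Rightarrow> 'a) \<Rightarrow> ('b::ab_group_add \<Rightarrow> 'b) \<Rightarrow> complex \<Rightarrow>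
    'a set \<Rightarrow> 'b set \<Rightarrow> ('a, 'b) label \<Rightarrow> ('a, 'b) label" where
  "dual \<theta>\<^sub>1 \<theta>\<^sub>2 s Gs \<Gamma>s (L0 u) = L0 u"
| "dual \<theta>\<^sub>1 \<theta>\<^sub>2 s Gs \<Gamma>s (Lpi u) = Lpi u"
| "dual \<theta>\<^sub>1 \<theta>\<^sub>2 s Gs \<Gamma>s (LK k \<epsilon>) = LK (- k) (s^2 * \<epsilon>)"
| "dual \<theta>\<^sub>1 \<theta>\<^sub>2 s Gs \<Gamma>s (LG g) = LG (if - g \<in> Gs then - g else \<theta>\<^sub>1 (- g))"
| "dual \<theta>\<^sub>1 \<theta>\<^sub>2 s Gs \<Gamma>s (LSigma \<sigma> \<epsilon>) = LSigma (- \<sigma>) (s^2 * \<epsilon>)"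
| "dual \<theta>\<^sub>1 \<theta>\<^sub>2 s Gs \<Gamma>s (LGamma \<gamma>) = LGamma (if - \<gamma> \<in> \<Gamma>s then - \<gamma> else \<theta>\<^sub>2 (- \<gamma>))"

fun T_entry :: "('a \<Rightarrow> complex) \<Rightarrow> ('b \<Rightarrow> complex) \<Rightarrow> ('a, 'b) label \<Rightarrow> complex" where
  "T_entry q\<^sub>1 q\<^sub>2 (L0 u) = q\<^sub>0 q\<^sub>1 u"
| "T_entry q\<^sub>1 q\<^sub>2 (Lpi u) = q\<^sub>0 q\<^sub>1 u"
| "T_entry q\<^sub>1 q\<^sub>2 (LK k \<epsilon>) = q\<^sub>1 k"
| "T_entry q\<^sub>1 q\<^sub>2 (LG g) = q\<^sub>1 g"
| "T_entry q\<^sub>1 q\<^sub>2 (LSigma \<sigma> \<epsilon>) = q\<^sub>2 \<sigma>"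
| "T_entry q\<^sub>1 q\<^sub>2 (LGamma \<gamma>) = q\<^sub>2 \<gamma>"

context
  fixes a b :: complex
    and q\<^sub>1 :: "'a::ab_group_add \<Rightarrow> complex" and \<theta>\<^sub>1 :: "'a \<Rightarrow> 'a"
    and q\<^sub>2 :: "'b::ab_group_add \<Rightarrow> complex" and \<theta>\<^sub>2 :: "'b \<Rightarrow> 'b"
    and s :: complex and f :: "'a \<Rightarrow> 'b \<Rightarrow> complex"
begin

text \<open>\<open>p0\<close>, \<open>p1\<close> and \<open>p2\<close> are the complex conjugates of the pairings.\<close>

private abbreviation (input) p0 :: "'a \<times> 'b \<Rightarrow> 'a \<times> 'b \<Rightarrow> complex" where
  "p0 u u' \<equiv> cnj (pairing (q\<^sub>0 q\<^sub>1) u u')"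
private abbreviation (input) p1 :: "'a \<Rightarrow> 'a \<Rightarrow> complex" where
  "p1 g g' \<equiv> cnj (pairing q\<^sub>1 g g')"
private abbreviation (input) p2 :: "'b \<Rightarrow> 'b \<Rightarrow> complex" where
  "p2 \<gamma> \<gamma>' \<equiv> cnj (pairing q\<^sub>2 \<gamma> \<gamma>')"

fun S_block :: "('a, 'b) label \<Rightarrow> ('a, 'b) label \<Rightarrow> complex" where
  "S_block (L0 u) (L0 u') = (a - b) / 2 * p0 u u'"
| "S_block (L0 u) (Lpi u') = (a + b) / 2 * p0 u u'"
| "S_block (L0 u) (LK k' \<epsilon>') = a / 2 * p1 (fst u) k'"
| "S_block (L0 u) (LG g') = a * p1 (fst u) g'"
| "S_block (L0 u) (LSigma \<sigma>' \<epsilon>') = b / 2 * p2 (snd u) \<sigma>'"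
| "S_block (L0 u) (LGamma \<gamma>') = b * p2 (snd u) \<gamma>'"

| "S_block (Lpi u) (L0 u') = (a + b) / 2 * p0 u u'"
| "S_block (Lpi u) (Lpi u') = (a - b) / 2 * p0 u u'"
| "S_block (Lpi u) (LK k' \<epsilon>') = a / 2 * p1 (fst u) k'"
| "S_block (Lpi u) (LG g') = a * p1 (fst u) g'"
| "S_block (Lpi u) (LSigma \<sigma>' \<epsilon>') = - (b / 2) * p2 (snd u) \<sigma>'"
| "S_block (Lpi u) (LGamma \<gamma>') = - b * p2 (snd u) \<gamma>'"

| "S_block (LK k \<epsilon>) (L0 u') = a / 2 * p1 k (fst u')"
| "S_block (LK k \<epsilon>) (Lpi u') = a / 2 * p1 k (fst u')"
| "S_block (LK k \<epsilon>) (LK k' \<epsilon>') = (a / 2 + \<epsilon> * \<epsilon>' * s / 4) * p1 k k'"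
| "S_block (LK k \<epsilon>) (LG g') = a * p1 k g'"
| "S_block (LK k \<epsilon>) (LSigma \<sigma>' \<epsilon>') = \<epsilon> * \<epsilon>' * f k \<sigma>' / 4"
| "S_block (LK k \<epsilon>) (LGamma \<gamma>') = 0"

| "S_block (LG g) (L0 u') = a * p1 g (fst u')"
| "S_block (LG g) (Lpi u') = a * p1 g (fst u')"
| "S_block (LG g) (LK k' \<epsilon>') = a * p1 g k'"
| "S_block (LG g) (LG g') = a * (p1 g g' + p1 g (\<theta>\<^sub>1 g'))"
| "S_block (LG g) (LSigma \<sigma>' \<epsilon>') = 0"
| "S_block (LG g) (LGamma \<gamma>') = 0"

| "S_block (LSigma \<sigma> \<epsilon>) (L0 u') = b / 2 * p2 \<sigma> (snd u')"
| "S_block (LSigma \<sigma> \<epsilon>) (Lpi u') = - (b / 2) * p2 \<sigma> (snd u')"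
| "S_block (LSigma \<sigma> \<epsilon>) (LK k' \<epsilon>') = \<epsilon> * \<epsilon>' * f k' \<sigma> / 4"
| "S_block (LSigma \<sigma> \<epsilon>) (LG g') = 0"
| "S_block (LSigma \<sigma> \<epsilon>) (LSigma \<sigma>' \<epsilon>') = - (b / 2 - \<epsilon> * \<epsilon>' * s / 4) * p2 \<sigma> \<sigma>'"
| "S_block (LSigma \<sigma> \<epsilon>) (LGamma \<gamma>') = - b * p2 \<sigma> \<gamma>'"

| "S_block (LGamma \<gamma>) (L0 u') = b * p2 \<gamma> (snd u')"
| "S_block (LGamma \<gamma>) (Lpi u') = - b * p2 \<gamma> (snd u')"
| "S_block (LGamma \<gamma>) (LK k' \<epsilon>') = 0"
| "S_block (LGamma \<gamma>) (LG g') = 0"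
| "S_block (LGamma \<gamma>) (LSigma \<sigma>' \<epsilon>') = - b * p2 \<gamma> \<sigma>'"
| "S_block (LGamma \<gamma>) (LGamma \<gamma>') = - b * (p2 \<gamma> \<gamma>' + p2 \<gamma> (\<theta>\<^sub>2 \<gamma>'))"

end

context
  fixes q\<^sub>1 :: "'a::{ab_group_add,finite} \<Rightarrow> complex" and \<theta>\<^sub>1 :: "'a \<Rightarrow> 'a"
    and q\<^sub>2 :: "'b::{ab_group_add,finite} \<Rightarrow> complex" and \<theta>\<^sub>2 :: "'b \<Rightarrow> 'b"
    and k\<^sub>0 :: 'a and \<sigma>\<^sub>0 :: 'b
    and s :: complex and f :: "'a \<Rightarrow> 'b \<Rightarrow> complex"
    and Gs :: "'a set" and \<Gamma>s :: "'b set"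
begin

definition S_entry :: "('a, 'b) label \<Rightarrow> ('a, 'b) label \<Rightarrow> complex" where
  "S_entry =
     S_block (complex_of_real (1 / sqrt (real CARD('a)))) (complex_of_real (1 / sqrt (real CARD('b))))
       q\<^sub>1 \<theta>\<^sub>1 q\<^sub>2 \<theta>\<^sub>2 s f"

private abbreviation (input) "J \<equiv> labels \<theta>\<^sub>1 \<theta>\<^sub>2 k\<^sub>0 \<sigma>\<^sub>0 Gs \<Gamma>s"
private abbreviation (input) "zero_label \<equiv> L0 (0, 0) :: ('a, 'b) label"

definition N_sym :: "('a, 'b) label \<Rightarrow> ('a, 'b) label \<Rightarrow> ('a, 'b) label \<Rightarrow> complex" where
  "N_sym x y z = (\<Sum>w\<in>J. S_entry w x * S_entry w y * S_entry w z / S_entry zero_label w)"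

definition N_coeff :: "('a, 'b) label \<Rightarrow> ('a, 'b) label \<Rightarrow> ('a, 'b) label \<Rightarrow> complex" where
  "N_coeff x y z = N_sym x y (dual \<theta>\<^sub>1 \<theta>\<^sub>2 s Gs \<Gamma>s z)"

definition FS_indicator :: "nat \<Rightarrow> ('a, 'b) label \<Rightarrow> complex" where
  "FS_indicator m z = (\<Sum>x\<in>J. \<Sum>y\<in>J. N_coeff x y z * S_entry zero_label x * S_entry zero_label y *
     (T_entry q\<^sub>1 q\<^sub>2 y / T_entry q\<^sub>1 q\<^sub>2 x) ^ m)"

definition FS2 :: bool where
  "FS2 \<longleftrightarrow> (\<forall>x\<in>J.
     (x \<noteq> dual \<theta>\<^sub>1 \<theta>\<^sub>2 s Gs \<Gamma>s x \<longrightarrow> FS_indicator 2 x = 0) \<and>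
     (x = dual \<theta>\<^sub>1 \<theta>\<^sub>2 s Gs \<Gamma>s x \<longrightarrow> FS_indicator 2 x \<in> {1, -1}))"

definition gauss_pair :: "'a \<times> 'b \<Rightarrow> nat \<Rightarrow> complex" where
  "gauss_pair v m =
     complex_of_real (1 / sqrt (real CARD('a))) * (\<Sum>g\<in>UNIV. pairing q\<^sub>1 (fst v) g * q\<^sub>1 g ^ m) +
     complex_of_real (1 / sqrt (real CARD('b))) * (\<Sum>\<gamma>\<in>UNIV. pairing q\<^sub>2 (snd v) \<gamma> * q\<^sub>2 \<gamma> ^ m)"

end

end

theory Submission
  imports Defs
begin

text \<open>Summing over the labels \<open>x\<close> and \<open>y\<close> first turns \<open>\<nu>\<^sub>m(z)\<close> into \<open>\<Sum>w. D w * S w (dual z)\<close>, where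
  \<open>D w\<close> is a squared norm of the Gauss sums \<open>\<tau> m h = 1/\<surd>|G| * (\<Sum>g. \<langle>h,g\<rangle> q(g)^m)\<close> of the two groups
  divided by \<open>S 0 w\<close>; the parts of \<open>S\<close> that depend on \<open>\<epsilon>\<close>, \<open>s\<close> and \<open>f\<close> cancel. The remaining sums over
  \<open>J\<close> complete to sums \<open>\<Sum>h. |\<tau> m h|\<^sup>2 \<langle>h,z\<rangle>\<close> over a whole group, which Fourier inversion evaluates to the
  delta terms, and the remainder on \<open>U\<close> becomes \<open>|\<tau>\<^sub>1 + \<tau>\<^sub>2|\<^sup>2/4\<close> because
  \<open>a\<^sup>2 b\<^sup>2 / (a\<^sup>2 - b\<^sup>2) = 1 / (|\<Gamma>| - |G|) = 1/4\<close>.\<close>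

section \<open>Characters and Gauss sums of a single metric group\<close>

context metric_group
begin

text \<open>The Fourier transform of \<open>q ^ m\<close> in the unitary normalisation. On
  \<open>U\<close> its values for the two groups add up to \<open>gauss_pair\<close>.\<close>

definition twisted_gauss :: "nat \<Rightarrow> 'a \<Rightarrow> complex" where
  "twisted_gauss m h =
     complex_of_real (1 / sqrt (real CARD('a))) * (\<Sum>g\<in>UNIV. pairing q h g * q g ^ m)"

lemma q_nonzero [simp]: "q g \<noteq> 0"
  using norm_q[of g] by auto

lemma q_mult_cnj: "q g * cnj (q g) = 1"
  by (simp add: complex_norm_square[symmetric] norm_q)

lemma q_add: "q (g + h) = pairing q g h * q g * q h"
  by (simp add: pairing_def field_simps)

lemma pairing_nonzero [simp]: "pairing q g h \<noteq> 0"
  by (simp add: pairing_def)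

lemma norm_pairing: "cmod (pairing q g h) = 1"
  by (simp add: pairing_def norm_mult norm_inverse norm_q)

lemma pairing_mult_cnj: "pairing q g h * cnj (pairing q g h) = 1"
  by (simp add: complex_norm_square[symmetric] norm_pairing)

lemma pairing_commute: "pairing q g h = pairing q h g"
  by (simp add: pairing_def add.commute)

lemma pairing_zero_left [simp]: "pairing q 0 h = 1"
  using pairing_add_left[of 0 0 h] by simp

lemma pairing_zero_right [simp]: "pairing q g 0 = 1"
  using pairing_zero_left[of g] by (simp add: pairing_commute)

lemma q_zero [simp]: "q 0 = 1"
  using pairing_zero_left[of 0] by (simp add: pairing_def)

lemma pairing_minus_left: "pairing q (- g) h = cnj (pairing q g h)"
proof -
  have "pairing q g h * pairing q (- g) h = pairing q g h * cnj (pairing q g h)"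
    using pairing_add_left[of g "- g" h] by (simp add: pairing_mult_cnj)
  then show ?thesis by simp
qed

lemma pairing_minus_right: "pairing q g (- h) = cnj (pairing q g h)"
  using pairing_minus_left[of h g] by (simp add: pairing_commute)

lemma pairing_diff_right: "pairing q g (h - h') = pairing q g h * cnj (pairing q g h')"
  using pairing_add_right[of g h "- h'"] by (simp add: pairing_minus_right)

text \<open>Evenness of \<open>q\<close> gives \<open>pairing q g (- g) = 1 / q g ^ 2\<close>, and
  negating an argument conjugates the pairing.\<close>

lemma pairing_self: "pairing q g g = q g ^ 2"
proof -
  have "pairing q g (- g) * q g ^ 2 = 1"
    by (simp add: pairing_def q_minus power2_eq_square field_simps)
  then have "pairing q g g * cnj (pairing q g g) * q g ^ 2 = pairing q g g"
    by (simp add: pairing_minus_right mult.assoc)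
  then show ?thesis
    by (simp add: pairing_mult_cnj)
qed

lemma pairing_nmult_right: "pairing q g (nmult m h) = pairing q g h ^ m"
  by (induction m) (simp_all add: nmult_def pairing_add_right)

text \<open>Orthogonality of characters: if \<open>g\<close> is nonzero, nondegeneracy supplies
  \<open>k\<close> with \<open>pairing q k g\<close> different from 1. Translation by
  \<open>k\<close> multiplies the sum by this value, so the sum vanishes.\<close>

lemma sum_pairing: "(\<Sum>h\<in>UNIV. pairing q h g) = of_bool (g = 0) * of_nat CARD('a)"
proof (cases "g = 0")
  case False
  then obtain k where k: "pairing q k g \<noteq> 1"
    using nondegenerate[of g] by (metis pairing_commute)
  have "(\<Sum>h\<in>UNIV. pairing q h g) = (\<Sum>h\<in>UNIV. pairing q (k + h) g)"
    by (rule sum.reindex_bij_witness[of _ "\<lambda>h. k + h" "\<lambda>h. h - k"]) auto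
  also have "\<dots> = pairing q k g * (\<Sum>h\<in>UNIV. pairing q h g)"
    by (simp add: pairing_add_left sum_distrib_left)
  finally show ?thesis
    using k False by simp
qed simp

text \<open>Here \<open>q u ^ (2 * m)\<close> is the pairing of \<open>u\<close> with
  \<open>nmult m u\<close>, hence 1, so \<open>q u ^ m\<close> is a sign and real. Fourier inversion
  produces the conjugated power, the indicator formulas the plain one.\<close>

lemma cnj_q_power:
  assumes "nmult m u = 0"
  shows "cnj (q u) ^ m = q u ^ m"
proof -
  have "q u ^ m * q u ^ m = 1"
    using pairing_nmult_right[of u m u] assms
    by (simp add: pairing_self power2_eq_square power_mult_distrib)
  moreover have "q u ^ m * cnj (q u) ^ m = 1"
    by (simp flip: power_mult_distrib add: q_mult_cnj)
  ultimately show ?thesis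
    by (metis q_nonzero mult_left_cancel power_not_zero)
qed

lemma scale_square: "complex_of_real (1 / sqrt (real CARD('a))) ^ 2 * of_nat CARD('a) = 1"
  by (simp add: power_divide flip: of_real_power)

lemma sum_minus: "(\<Sum>g\<in>UNIV. F (- g)) = (\<Sum>g\<in>UNIV. F (g :: 'a))"
  by (rule sum.reindex_bij_witness[of _ uminus uminus]) auto

text \<open>The entries of \<open>S\<close> carry conjugated pairings; the substitution of
  \<open>- g\<close> for \<open>g\<close> removes the conjugation because \<open>q\<close> is
  even.\<close>

lemma twisted_gauss_conv_cnj_pairing:
  "complex_of_real (1 / sqrt (real CARD('a))) * (\<Sum>g\<in>UNIV. cnj (pairing q h g) * q g ^ m)
    = twisted_gauss m h"
  using sum_minus[of "\<lambda>g. pairing q h g * q g ^ m"]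
  by (simp add: twisted_gauss_def pairing_minus_right q_minus)

lemma cnj_twisted_gauss:
  "complex_of_real (1 / sqrt (real CARD('a))) * (\<Sum>g\<in>UNIV. cnj (pairing q h g) * cnj (q g) ^ m)
    = cnj (twisted_gauss m h)"
  by (simp add: twisted_gauss_def)

text \<open>Fourier inversion: the autocorrelation \<open>\<Sum>g. q g ^ m * cnj (q (g + u)) ^ m\<close> is a character
  sum, because the quadratic terms in \<open>g\<close> cancel.\<close>

lemma fourier_norm_twisted_gauss:
  "complex_of_real (1 / sqrt (real CARD('a))) ^ 2 *
     (\<Sum>h\<in>UNIV. twisted_gauss m h * cnj (twisted_gauss m h) * pairing q h u)
   = of_bool (nmult m u = 0) * q u ^ m"
proof -
  define a where "a = complex_of_real (1 / sqrt (real CARD('a)))"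
  have [simp]: "cnj a = a" and a: "a ^ 2 * of_nat CARD('a) = 1"
    using scale_square by (simp_all add: a_def)
  have q_corr: "q g * cnj (q (g + u)) = cnj (pairing q g u) * cnj (q u)" for g
    using q_mult_cnj[of g] by (simp add: q_add)
  have "(\<Sum>h\<in>UNIV. twisted_gauss m h * cnj (twisted_gauss m h) * pairing q h u) =
      (\<Sum>h\<in>UNIV. \<Sum>g\<in>UNIV. \<Sum>g'\<in>UNIV. a ^ 2 * (q g ^ m * cnj (q g') ^ m) * pairing q h (g - g' + u))"
    unfolding twisted_gauss_def a_def[symmetric]
    by (intro sum.cong refl)
      (simp add: sum_product sum_distrib_left sum_distrib_right power2_eq_square
        pairing_add_right pairing_diff_right mult_ac, rule sum.swap)
  \<comment> \<open>With \<open>h\<close> innermost, orthogonality leaves only the diagonal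
    \<open>g' = g + u\<close>.\<close>
  also have "\<dots> = (\<Sum>g\<in>UNIV. \<Sum>g'\<in>UNIV. \<Sum>h\<in>UNIV.
      a ^ 2 * (q g ^ m * cnj (q g') ^ m) * pairing q h (g - g' + u))"
    by (subst sum.swap) (intro sum.cong refl sum.swap)
  also have "\<dots> = (\<Sum>g\<in>UNIV. \<Sum>g'\<in>UNIV. if g' = g + u then q g ^ m * cnj (q g') ^ m else 0)"
  proof (intro sum.cong refl)
    fix g g' :: 'a
    have "g - g' + u = 0 \<longleftrightarrow> g' = g + u"
      by (auto simp: algebra_simps)
    moreover have "(\<Sum>h\<in>UNIV. a ^ 2 * (q g ^ m * cnj (q g') ^ m) * pairing q h (g - g' + u)) =
        q g ^ m * cnj (q g') ^ m * (a ^ 2 * of_nat CARD('a)) * of_bool (g - g' + u = 0)"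
      by (subst sum_distrib_left[symmetric], subst sum_pairing) (simp add: mult_ac)
    ultimately show "(\<Sum>h\<in>UNIV. a ^ 2 * (q g ^ m * cnj (q g') ^ m) * pairing q h (g - g' + u)) =
        (if g' = g + u then q g ^ m * cnj (q g') ^ m else 0)"
      by (simp only: a) simp
  qed
  also have "\<dots> = (\<Sum>g\<in>UNIV. (q g * cnj (q (g + u))) ^ m)"
    by (simp add: power_mult_distrib)
  \<comment> \<open>The \<open>m\<close>-th power of the character attached to \<open>u\<close> is
    the one attached to \<open>nmult m u\<close>, so a second use of orthogonality yields the
    delta.\<close>
  also have "\<dots> = cnj (q u) ^ m * cnj (\<Sum>g\<in>UNIV. pairing q g (nmult m u))"
    by (simp add: q_corr pairing_nmult_right power_mult_distrib sum_distrib_left mult_ac)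
  also have "\<dots> = of_bool (nmult m u = 0) * cnj (q u) ^ m * of_nat CARD('a)"
    by (subst sum_pairing) simp
  finally show ?thesis
    using a cnj_q_power[of m u] unfolding a_def[symmetric] by auto
qed

end

section \<open>Orbits of the involution\<close>

locale orbit_metric_group = involutive_metric_group q \<theta>
  for q :: "'a::{ab_group_add,finite} \<Rightarrow> complex" and \<theta> :: "'a \<Rightarrow> 'a" +
  fixes k\<^sub>0 :: 'a and R :: "'a set"
  assumes k0_fixed: "\<theta> k\<^sub>0 = k\<^sub>0" and k0_nonzero: "k\<^sub>0 \<noteq> 0" and k0_order: "k\<^sub>0 + k\<^sub>0 = 0"
    and representatives: "orbit_representatives \<theta> R"
begin

lemma theta_zero: "\<theta> 0 = 0"
  using theta_add[of 0 0] by simp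

lemma theta_minus: "\<theta> (- g) = - \<theta> g"
  using theta_add[of g "- g"] by (simp add: theta_zero eq_neg_iff_add_eq_0 add.commute)

lemma pairing_theta: "pairing q (\<theta> g) (\<theta> h) = pairing q g h"
  by (simp add: pairing_def q_theta flip: theta_add)

lemma pairing_theta_swap: "pairing q (\<theta> g) h = pairing q g (\<theta> h)"
  using pairing_theta[of g "\<theta> h"] by (simp add: theta_theta)

lemma star_fixed: "k \<in> star_part \<theta> k\<^sub>0 \<Longrightarrow> \<theta> k = k"
  by (simp add: star_part_def fixed_points_def)

text \<open>The splitting mirrors the label blocks: a label in \<open>R\<close> stands for the two
  group elements \<open>g\<close> and \<open>\<theta> g\<close>. It turns sums over labels into sums
  over the group and back.\<close>

lemma sum_orbits:
  "(\<Sum>g\<in>UNIV. F g) =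
    F 0 + F k\<^sub>0 + (\<Sum>k\<in>star_part \<theta> k\<^sub>0. F k) + (\<Sum>g\<in>R. F g + F (\<theta> g))"
  for F :: "'a \<Rightarrow> complex"
proof -
  let ?A = "fixed_points \<theta>"
  have univ: "UNIV = ?A \<union> (R \<union> \<theta> ` R)" and disj: "?A \<inter> (R \<union> \<theta> ` R) = {}" "R \<inter> \<theta> ` R = {}"
    using representatives by (auto simp: orbit_representatives_def)
  have fixed: "?A = insert 0 (insert k\<^sub>0 (star_part \<theta> k\<^sub>0))"
    by (auto simp: star_part_def fixed_points_def theta_zero k0_fixed)
  have "(\<Sum>g\<in>UNIV. F g) = sum F ?A + (sum F R + sum F (\<theta> ` R))"
    using disj by (subst univ) (simp add: sum.union_disjoint)
  also have "sum F ?A = F 0 + F k\<^sub>0 + (\<Sum>k\<in>star_part \<theta> k\<^sub>0. F k)"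
    using k0_nonzero by (subst fixed) (simp add: star_part_def)
  also have "sum F (\<theta> ` R) = (\<Sum>g\<in>R. F (\<theta> g))"
    by (subst sum.reindex) (metis bij_is_inj inj_on_subset subset_UNIV theta_bij, simp)
  finally show ?thesis
    by (simp add: sum.distrib add.assoc)
qed

lemma sum_theta: "(\<Sum>g\<in>UNIV. F (\<theta> g)) = (\<Sum>g\<in>UNIV. F g)"
  by (rule sum.reindex_bij_witness[of _ \<theta> \<theta>]) (auto simp: theta_theta)

lemma twisted_gauss_theta: "twisted_gauss m (\<theta> h) = twisted_gauss m h"
  using sum_theta[of "\<lambda>g. pairing q h g * q g ^ m"]
  by (simp add: twisted_gauss_def pairing_theta_swap q_theta)

lemma nmult_k0: "nmult m k\<^sub>0 = (if even m then 0 else k\<^sub>0)"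
  by (induction m) (auto simp: nmult_def k0_order)

end

lemma mixed_norm_identities:
  fixes a b X Y R :: complex
  assumes ab: "4 * a\<^sup>2 * b\<^sup>2 = a\<^sup>2 - b\<^sup>2" and ne: "a - b \<noteq> 0" "a + b \<noteq> 0"
  defines "P \<equiv> (a\<^sup>2 * X + b\<^sup>2 * Y + a * b * R) / (2 * (a - b))"
    and "M \<equiv> (a\<^sup>2 * X + b\<^sup>2 * Y - a * b * R) / (2 * (a + b))"
  shows "P * ((a - b) / 2) + M * ((a + b) / 2) = (a\<^sup>2 * X + b\<^sup>2 * Y) / 2"
    and "P * ((a + b) / 2) + M * ((a - b) / 2) = (X + Y + R) / 4 + (a\<^sup>2 * X - b\<^sup>2 * Y) / 2"
    and "a * (P + M) = (X + Y + R) / 4 + a\<^sup>2 * X"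
    and "b * (P - M) = (X + Y + R) / 4 - b\<^sup>2 * Y"
proof -
  define D where "D = 2 * (a - b) * (a + b)"
  define NP where "NP = a\<^sup>2 * X + b\<^sup>2 * Y + a * b * R"
  define NM where "NM = a\<^sup>2 * X + b\<^sup>2 * Y - a * b * R"
  have D: "D \<noteq> 0"
    using ne by (simp add: D_def)
  have n: "2 * (a - b) \<noteq> 0" "2 * (a + b) \<noteq> 0"
    using ne by (metis mult_eq_0_iff zero_neq_numeral)+
  have P: "P = NP * (a + b) / D"
    unfolding P_def NP_def[symmetric] using n(1) D by (subst frac_eq_eq) (simp_all add: D_def)
  have M: "M = NM * (a - b) / D"
    unfolding M_def NM_def[symmetric] using n(2) D
    by (subst frac_eq_eq) (assumption, assumption, simp add: D_def algebra_simps)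
  show "P * ((a - b) / 2) + M * ((a + b) / 2) = (a\<^sup>2 * X + b\<^sup>2 * Y) / 2"
  proof -
    have "P * (2 * (a - b)) = NP" "M * (2 * (a + b)) = NM"
      using n unfolding P_def M_def NP_def NM_def 
      by (simp_all only: times_divide_eq_left nonzero_mult_div_cancel_right simp_thms)
    moreover have "P * ((a - b) / 2) + M * ((a + b) / 2) =
        (P * (2 * (a - b)) + M * (2 * (a + b))) / 4"
      by (simp add: field_simps)
    ultimately have "P * ((a - b) / 2) + M * ((a + b) / 2) = (NP + NM) / 4"
      by (simp only:)
    then show ?thesis
      by (simp only: NP_def NM_def) (simp add: field_simps)
  qed
  \<comment> \<open>The defect of \<open>ab\<close> is kept as an explicit term: after
    multiplication by \<open>D\<close> each claim is a polynomial identity up to a multiple of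
    \<open>e\<close>, provable by plain expansion.\<close>
  define e where "e = 4 * a\<^sup>2 * b\<^sup>2 - (a\<^sup>2 - b\<^sup>2)"
  have e: "e = 0"
    using ab by (simp add: e_def)
  show "P * ((a + b) / 2) + M * ((a - b) / 2) = (X + Y + R) / 4 + (a\<^sup>2 * X - b\<^sup>2 * Y) / 2"
  proof -
    have "NP * (a + b) * ((a + b) / 2) + NM * (a - b) * ((a - b) / 2) =
        D * ((X + Y + R) / 4 + (a\<^sup>2 * X - b\<^sup>2 * Y) / 2) + (X + Y + R) / 2 * e"
      by (simp add: NP_def NM_def D_def e_def field_simps power2_eq_square)
    moreover have "P * ((a + b) / 2) + M * ((a - b) / 2) =
        (NP * (a + b) * ((a + b) / 2) + NM * (a - b) * ((a - b) / 2)) / D"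
      unfolding P M using D by (simp add: field_simps)
    ultimately show ?thesis
      by (simp only: e mult_zero_right add_0_right nonzero_mult_div_cancel_left[OF D])
  qed
  show "a * (P + M) = (X + Y + R) / 4 + a\<^sup>2 * X"
  proof -
    have "a * (NP * (a + b) + NM * (a - b)) =
        D * ((X + Y + R) / 4 + a\<^sup>2 * X) + (X + Y + R) / 2 * e"
      by (simp add: NP_def NM_def D_def e_def field_simps power2_eq_square)
    moreover have "a * (P + M) =
        (a * (NP * (a + b) + NM * (a - b))) / D"
      unfolding P M using D by (simp add: field_simps)
    ultimately show ?thesis
      by (simp only: e mult_zero_right add_0_right nonzero_mult_div_cancel_left[OF D])
  qed
  show "b * (P - M) = (X + Y + R) / 4 - b\<^sup>2 * Y"
  proof -
    have "b * (NP * (a + b) - NM * (a - b)) =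
        D * ((X + Y + R) / 4 - b\<^sup>2 * Y) + (X + Y + R) / 2 * e"
      by (simp add: NP_def NM_def D_def e_def field_simps power2_eq_square)
    moreover have "b * (P - M) =
        (b * (NP * (a + b) - NM * (a - b))) / D"
      unfolding P M using D by (simp add: field_simps)
    ultimately show ?thesis
      by (simp only: e mult_zero_right add_0_right nonzero_mult_div_cancel_left[OF D])
  qed
qed

section \<open>Two metric groups glued along \<open>U\<close>, and sums over the labels\<close>

locale orbit_metric_group_pair =
  A: orbit_metric_group q\<^sub>1 \<theta>\<^sub>1 k\<^sub>0 Gs + B: orbit_metric_group q\<^sub>2 \<theta>\<^sub>2 \<sigma>\<^sub>0 \<Gamma>s
  for q\<^sub>1 :: "'a::{ab_group_add,finite} \<Rightarrow> complex" and \<theta>\<^sub>1 k\<^sub>0 Gs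
    and q\<^sub>2 :: "'b::{ab_group_add,finite} \<Rightarrow> complex" and \<theta>\<^sub>2 \<sigma>\<^sub>0 \<Gamma>s +
  fixes s :: complex and f :: "'a \<Rightarrow> 'b \<Rightarrow> complex"
  assumes q_glue: "q\<^sub>1 k\<^sub>0 = q\<^sub>2 \<sigma>\<^sub>0" and card_add: "CARD('b) = CARD('a) + 4"
begin

definition a :: complex where "a = complex_of_real (1 / sqrt (real CARD('a)))"
definition b :: complex where "b = complex_of_real (1 / sqrt (real CARD('b)))"

abbreviation "J \<equiv> labels \<theta>\<^sub>1 \<theta>\<^sub>2 k\<^sub>0 \<sigma>\<^sub>0 Gs \<Gamma>s"
abbreviation "S \<equiv> S_block a b q\<^sub>1 \<theta>\<^sub>1 q\<^sub>2 \<theta>\<^sub>2 s f"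
abbreviation "U \<equiv> common_subgroup k\<^sub>0 \<sigma>\<^sub>0"
abbreviation "Ks \<equiv> star_part \<theta>\<^sub>1 k\<^sub>0"
abbreviation "\<Sigma>s \<equiv> star_part \<theta>\<^sub>2 \<sigma>\<^sub>0"
abbreviation "\<tau>\<^sub>1 \<equiv> A.twisted_gauss"
abbreviation "\<tau>\<^sub>2 \<equiv> B.twisted_gauss"

lemma S_entry_eq: "S_entry q\<^sub>1 \<theta>\<^sub>1 q\<^sub>2 \<theta>\<^sub>2 s f = S"
  by (simp add: S_entry_def a_def b_def)

lemma ab_nonzero [simp]: "a \<noteq> 0" "b \<noteq> 0"
  by (simp_all add: a_def b_def)

text \<open>This is \<open>1 / b\<^sup>2 - 1 / a\<^sup>2 = 4\<close>, the relation between the two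
  cardinalities, with denominators cleared.\<close>

lemma ab_square: "4 * a\<^sup>2 * b\<^sup>2 = a\<^sup>2 - b\<^sup>2"
proof -
  have "a\<^sup>2 * of_nat CARD('a) = 1" "b\<^sup>2 * (of_nat CARD('a) + 4) = 1"
    using A.scale_square B.scale_square by (simp_all add: a_def b_def card_add)
  then show ?thesis by algebra
qed

text \<open>The product of the two is \<open>4 * a\<^sup>2 * b\<^sup>2\<close>, which is nonzero.
  Both occur in the row of the label \<open>0\<close> and so become denominators of the weights on
  \<open>U\<close>.\<close>

lemma a_diff_b: "a - b \<noteq> 0" and a_plus_b: "a + b \<noteq> 0"
proof -
  have "(a - b) * (a + b) = 4 * a\<^sup>2 * b\<^sup>2"
    using ab_square by algebra
  then show "a - b \<noteq> 0" "a + b \<noteq> 0" by auto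
qed

text \<open>Since a self-pairing is the square of \<open>q\<close>, gluing the values of the
  quadratic forms already glues the pairings on \<open>U\<close>.\<close>

lemma glue_pairing: "pairing q\<^sub>1 k\<^sub>0 k\<^sub>0 = pairing q\<^sub>2 \<sigma>\<^sub>0 \<sigma>\<^sub>0"
  by (simp add: A.pairing_self B.pairing_self q_glue)

lemma pairing_q0: "pairing (q\<^sub>0 q\<^sub>1) u v = pairing q\<^sub>1 (fst u) (fst v)"
  by (simp add: pairing_def q\<^sub>0_def)

lemma U_pairing: "u \<in> U \<Longrightarrow> pairing q\<^sub>1 (fst u) k\<^sub>0 = pairing q\<^sub>2 (snd u) \<sigma>\<^sub>0"
  by (auto simp: common_subgroup_def glue_pairing)

lemma U_fixed: "u \<in> U \<Longrightarrow> \<theta>\<^sub>1 (fst u) = fst u" "u \<in> U \<Longrightarrow> \<theta>\<^sub>2 (snd u) = snd u"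
  by (auto simp: common_subgroup_def A.theta_zero A.k0_fixed B.theta_zero B.k0_fixed)

lemma sum_U: "(\<Sum>u\<in>U. F u) = F (0, 0) + F (k\<^sub>0, \<sigma>\<^sub>0)" for F :: "_ \<Rightarrow> complex"
  using A.k0_nonzero by (simp add: common_subgroup_def)

lemma sum_labels:
  "(\<Sum>x\<in>J. F x) =
    F (L0 (0, 0)) + F (L0 (k\<^sub>0, \<sigma>\<^sub>0)) + F (Lpi (0, 0)) + F (Lpi (k\<^sub>0, \<sigma>\<^sub>0)) +
    (\<Sum>k\<in>Ks. F (LK k 1) + F (LK k (- 1))) + (\<Sum>g\<in>Gs. F (LG g)) +
    (\<Sum>\<sigma>\<in>\<Sigma>s. F (LSigma \<sigma> 1) + F (LSigma \<sigma> (- 1))) + (\<Sum>\<gamma>\<in>\<Gamma>s. F (LGamma \<gamma>))"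
  for F :: "_ \<Rightarrow> complex"
proof -
  let ?E = "{1, -1} :: complex set"
  let ?K = "(\<lambda>(k, \<epsilon>). LK k \<epsilon>) ` (Ks \<times> ?E) :: ('a, 'b) label set"
  let ?S = "(\<lambda>(\<sigma>, \<epsilon>). LSigma \<sigma> \<epsilon>) ` (\<Sigma>s \<times> ?E) :: ('a, 'b) label set"
  \<comment> \<open>Nesting to the right lets \<open>sum.union_disjoint\<close> split off one block
    at a time.\<close>
  have J: "J = L0 ` U \<union> (Lpi ` U \<union> (?K \<union> (LG ` Gs \<union> (?S \<union> LGamma ` \<Gamma>s))))"
    by (auto simp: labels_def image_iff)
  have [simp]: "finite U"
    by (simp add: common_subgroup_def)
  have "sum F (L0 ` U) = F (L0 (0, 0)) + F (L0 (k\<^sub>0, \<sigma>\<^sub>0))"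
    "sum F (Lpi ` U) = F (Lpi (0, 0)) + F (Lpi (k\<^sub>0, \<sigma>\<^sub>0))"
    by (subst sum.reindex; simp add: inj_on_def sum_U)+
  moreover have "sum F (LG ` Gs) = (\<Sum>g\<in>Gs. F (LG g))"
    "sum F (LGamma ` \<Gamma>s) = (\<Sum>\<gamma>\<in>\<Gamma>s. F (LGamma \<gamma>))"
    by (subst sum.reindex; simp add: inj_on_def)+
  moreover have "sum F ?K = (\<Sum>(k, \<epsilon>)\<in>Ks \<times> ?E. F (LK k \<epsilon>))"
    by (subst sum.reindex) (auto simp: inj_on_def case_prod_unfold)
  moreover have "sum F ?S = (\<Sum>(\<sigma>, \<epsilon>)\<in>\<Sigma>s \<times> ?E. F (LSigma \<sigma> \<epsilon>))"
    by (subst sum.reindex) (auto simp: inj_on_def case_prod_unfold)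
  moreover have "sum F J = sum F (L0 ` U) + (sum F (Lpi ` U) + (sum F ?K + (sum F (LG ` Gs) +
      (sum F ?S + sum F (LGamma ` \<Gamma>s)))))"
    unfolding J by ((subst sum.union_disjoint, simp, simp, force)+, rule refl)
  ultimately show ?thesis
    by (simp add: add.assoc flip: sum.cartesian_product)
qed

text \<open>Each row of \<open>S\<close>, multiplied by the row of \<open>0\<close>, is a Fourier
  sum over one or both groups. General \<open>t\<^sub>1\<close> and \<open>t\<^sub>2\<close> cover
  both the powers of \<open>q\<close>, for the sum over \<open>y\<close>, and their conjugates, for
  the sum over \<open>x\<close>.\<close>

lemma row_sums:
  fixes t\<^sub>1 t\<^sub>2
  assumes t1: "\<And>g. t\<^sub>1 (\<theta>\<^sub>1 g) = t\<^sub>1 g" and t2: "\<And>\<gamma>. t\<^sub>2 (\<theta>\<^sub>2 \<gamma>) = t\<^sub>2 \<gamma>"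
    and t_glue: "t\<^sub>1 0 = t\<^sub>2 0" "t\<^sub>1 k\<^sub>0 = t\<^sub>2 \<sigma>\<^sub>0"
  defines "P\<^sub>1 \<equiv> \<lambda>h. a * (\<Sum>g\<in>UNIV. cnj (pairing q\<^sub>1 h g) * t\<^sub>1 g)"
    and "P\<^sub>2 \<equiv> \<lambda>h. b * (\<Sum>\<gamma>\<in>UNIV. cnj (pairing q\<^sub>2 h \<gamma>) * t\<^sub>2 \<gamma>)"
    and "L \<equiv> \<lambda>w. \<Sum>y\<in>J. S w y * S (L0 (0, 0)) y * T_entry t\<^sub>1 t\<^sub>2 y"
  shows "u \<in> U \<Longrightarrow> L (L0 u) = (a * P\<^sub>1 (fst u) + b * P\<^sub>2 (snd u)) / 2"
    and "u \<in> U \<Longrightarrow> L (Lpi u) = (a * P\<^sub>1 (fst u) - b * P\<^sub>2 (snd u)) / 2"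
    and "k \<in> Ks \<Longrightarrow> L (LK k \<epsilon>) = a / 2 * P\<^sub>1 k"
    and "L (LG g) = a * P\<^sub>1 g"
    and "\<sigma> \<in> \<Sigma>s \<Longrightarrow> L (LSigma \<sigma> \<epsilon>) = - (b / 2) * P\<^sub>2 \<sigma>"
    and "L (LGamma \<gamma>) = - b * P\<^sub>2 \<gamma>"
proof -
  define p\<^sub>1 where "p\<^sub>1 h g = cnj (pairing q\<^sub>1 h g)" for h g
  define p\<^sub>2 where "p\<^sub>2 h \<gamma> = cnj (pairing q\<^sub>2 h \<gamma>)" for h \<gamma>
  define K where "K h = (\<Sum>k\<in>Ks. p\<^sub>1 h k * t\<^sub>1 k)" for h
  define N where "N h = (\<Sum>\<sigma>\<in>\<Sigma>s. p\<^sub>2 h \<sigma> * t\<^sub>2 \<sigma>)" for h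
  have p_simps [simp]: "p\<^sub>1 h 0 = 1" "p\<^sub>1 0 g = 1" "p\<^sub>2 h' 0 = 1" "p\<^sub>2 0 \<gamma>' = 1" for h g h' \<gamma>'
    by (simp_all add: p\<^sub>1_def p\<^sub>2_def)
  have P\<^sub>1: "P\<^sub>1 h = a * (t\<^sub>1 0 + p\<^sub>1 h k\<^sub>0 * t\<^sub>1 k\<^sub>0 + K h +
      (\<Sum>g\<in>Gs. (p\<^sub>1 h g + p\<^sub>1 h (\<theta>\<^sub>1 g)) * t\<^sub>1 g))" for h
    unfolding P\<^sub>1_def p\<^sub>1_def[symmetric] K_def by (subst A.sum_orbits) (simp add: t1 distrib_right)
  have P\<^sub>2: "P\<^sub>2 h = b * (t\<^sub>2 0 + p\<^sub>2 h \<sigma>\<^sub>0 * t\<^sub>2 \<sigma>\<^sub>0 + N h +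
      (\<Sum>\<gamma>\<in>\<Gamma>s. (p\<^sub>2 h \<gamma> + p\<^sub>2 h (\<theta>\<^sub>2 \<gamma>)) * t\<^sub>2 \<gamma>))" for h
    unfolding P\<^sub>2_def p\<^sub>2_def[symmetric] N_def by (subst B.sum_orbits) (simp add: t2 distrib_right)
  have fix1: "p\<^sub>1 h (\<theta>\<^sub>1 g) = p\<^sub>1 h g" if "\<theta>\<^sub>1 h = h" for h g
    using A.pairing_theta_swap[of h g] that by (simp add: p\<^sub>1_def)
  have fix2: "p\<^sub>2 h (\<theta>\<^sub>2 \<gamma>) = p\<^sub>2 h \<gamma>" if "\<theta>\<^sub>2 h = h" for h \<gamma>
    using B.pairing_theta_swap[of h \<gamma>] that by (simp add: p\<^sub>2_def)
  \<comment> \<open>A fixed \<open>h\<close> pairs equally with \<open>g\<close> and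
    \<open>\<theta>\<^sub>1 g\<close>, so each representative counts twice. This matches the rows of
    fixed points, whose entries contain one character value instead of the sum of two.\<close>
  have P\<^sub>1_fixed: "P\<^sub>1 h = a * (t\<^sub>1 0 + p\<^sub>1 h k\<^sub>0 * t\<^sub>1 k\<^sub>0 + K h + 2 * (\<Sum>g\<in>Gs. p\<^sub>1 h g * t\<^sub>1 g))"
    if "\<theta>\<^sub>1 h = h" for h
    by (simp add: P\<^sub>1 fix1[OF that] sum_distrib_left mult.assoc)
  have P\<^sub>2_fixed: "P\<^sub>2 h = b * (t\<^sub>2 0 + p\<^sub>2 h \<sigma>\<^sub>0 * t\<^sub>2 \<sigma>\<^sub>0 + N h + 2 * (\<Sum>\<gamma>\<in>\<Gamma>s. p\<^sub>2 h \<gamma> * t\<^sub>2 \<gamma>))"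
    if "\<theta>\<^sub>2 h = h" for h
    by (simp add: P\<^sub>2 fix2[OF that] sum_distrib_left mult.assoc)
  have K: "(\<Sum>k\<in>Ks. x * p\<^sub>1 h k * y * t\<^sub>1 k) = x * y * K h" for x y h
    by (simp add: K_def sum_distrib_left mult_ac)
  have N: "(\<Sum>\<sigma>\<in>\<Sigma>s. x * p\<^sub>2 h \<sigma> * y * t\<^sub>2 \<sigma>) = x * y * N h" for x y h
    by (simp add: N_def sum_distrib_left mult_ac)
  have Gsum: "(\<Sum>g\<in>Gs. x * F g * y * t\<^sub>1 g) = x * y * (\<Sum>g\<in>Gs. F g * t\<^sub>1 g)" for x y F
    by (simp add: sum_distrib_left mult_ac)
  have \<Gamma>sum: "(\<Sum>g\<in>\<Gamma>s. x * F g * y * t\<^sub>2 g) = x * y * (\<Sum>g\<in>\<Gamma>s. F g * t\<^sub>2 g)" for x y F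
    by (simp add: sum_distrib_left mult_ac)
  have zero: "S (L0 (0, 0)) (L0 v) = (a - b) / 2" "S (L0 (0, 0)) (Lpi v) = (a + b) / 2"
    "S (L0 (0, 0)) (LK k \<epsilon>) = a / 2" "S (L0 (0, 0)) (LG g) = a"
    "S (L0 (0, 0)) (LSigma \<sigma> \<epsilon>) = b / 2" "S (L0 (0, 0)) (LGamma \<gamma>) = b" for v k \<epsilon> g \<sigma> \<gamma>
    by (simp_all add: pairing_q0)
  note S_simps = S_block.simps[where a = a and b = b and q\<^sub>1 = q\<^sub>1 and \<theta>\<^sub>1 = \<theta>\<^sub>1
      and q\<^sub>2 = q\<^sub>2 and \<theta>\<^sub>2 = \<theta>\<^sub>2 and s = s and f = f, folded p\<^sub>1_def p\<^sub>2_def, unfolded pairing_q0, folded p\<^sub>1_def p\<^sub>2_def]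
  have glue: "p\<^sub>1 (fst u) k\<^sub>0 = p\<^sub>2 (snd u) \<sigma>\<^sub>0" if "u \<in> U" for u
    using U_pairing[OF that] by (simp add: p\<^sub>1_def p\<^sub>2_def)
  have t0: "T_entry t\<^sub>1 t\<^sub>2 (L0 v) = t\<^sub>1 (fst v)" "T_entry t\<^sub>1 t\<^sub>2 (Lpi v) = t\<^sub>1 (fst v)" for v
    by (simp_all add: q\<^sub>0_def)
  {
    assume u: "u \<in> U"
    show "L (L0 u) = (a * P\<^sub>1 (fst u) + b * P\<^sub>2 (snd u)) / 2"
      unfolding L_def sum_labels zero t0 unfolding S_simps T_entry.simps sum.distrib K N Gsum \<Gamma>sum
      by (simp add: P\<^sub>1_fixed P\<^sub>2_fixed U_fixed[OF u] glue[OF u] t_glue field_simps)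
    show "L (Lpi u) = (a * P\<^sub>1 (fst u) - b * P\<^sub>2 (snd u)) / 2"
      unfolding L_def sum_labels zero t0 unfolding S_simps T_entry.simps sum.distrib K N Gsum \<Gamma>sum
      by (simp add: P\<^sub>1_fixed P\<^sub>2_fixed U_fixed[OF u] glue[OF u] t_glue field_simps)
  }
  \<comment> \<open>The row of \<open>0\<close> and the values of \<open>t\<^sub>1\<close>,
    \<open>t\<^sub>2\<close> ignore the sign of a label, so the terms with \<open>s\<close> and
    \<open>f\<close> cancel between the signs 1 and -1, here and in the row of
    \<open>LSigma\<close>.\<close>
  show "L (LK k \<epsilon>) = a / 2 * P\<^sub>1 k" if "k \<in> Ks"
    unfolding L_def sum_labels zero t0 unfolding S_simps T_entry.simps sum.distrib K N Gsum \<Gamma>sum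
    by (simp add: P\<^sub>1_fixed A.star_fixed[OF that] field_simps sum_negf)
  show "L (LG g) = a * P\<^sub>1 g"
    unfolding L_def sum_labels zero t0 unfolding S_simps T_entry.simps sum.distrib K N Gsum \<Gamma>sum
    by (simp add: P\<^sub>1 field_simps)
  show "L (LSigma \<sigma> \<epsilon>) = - (b / 2) * P\<^sub>2 \<sigma>" if "\<sigma> \<in> \<Sigma>s"
    unfolding L_def sum_labels zero t0 unfolding S_simps T_entry.simps sum.distrib K N Gsum \<Gamma>sum
    by (simp add: P\<^sub>2_fixed B.star_fixed[OF that] t_glue field_simps sum_negf)
  show "L (LGamma \<gamma>) = - b * P\<^sub>2 \<gamma>"
    unfolding L_def sum_labels zero t0 unfolding S_simps T_entry.simps sum.distrib K N Gsum \<Gamma>sum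
    by (simp add: P\<^sub>2 t_glue field_simps)
qed

section \<open>Weights of the labels and reduction of the indicators to them\<close>

definition weight :: "nat \<Rightarrow> ('a, 'b) label \<Rightarrow> complex" where
  "weight m w =
     (\<Sum>y\<in>J. S w y * S (L0 (0, 0)) y * T_entry (\<lambda>g. q\<^sub>1 g ^ m) (\<lambda>\<gamma>. q\<^sub>2 \<gamma> ^ m) y) *
     (\<Sum>x\<in>J. S w x * S (L0 (0, 0)) x * T_entry (\<lambda>g. cnj (q\<^sub>1 g) ^ m) (\<lambda>\<gamma>. cnj (q\<^sub>2 \<gamma>) ^ m) x) /
     S (L0 (0, 0)) w"

text \<open>With \<open>w\<close> outermost the summand factors into a part in \<open>x\<close> and
  a part in \<open>y\<close>, since inverting a number of modulus one is conjugation. The label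
  \<open>z\<close> survives only in one column of \<open>S\<close>.\<close>

lemma FS_indicator_eq_weight:
  "FS_indicator q\<^sub>1 \<theta>\<^sub>1 q\<^sub>2 \<theta>\<^sub>2 k\<^sub>0 \<sigma>\<^sub>0 s f Gs \<Gamma>s m z =
    (\<Sum>w\<in>J. weight m w * S w (dual \<theta>\<^sub>1 \<theta>\<^sub>2 s Gs \<Gamma>s z))"
proof -
  define t where "t y = T_entry (\<lambda>g. q\<^sub>1 g ^ m) (\<lambda>\<gamma>. q\<^sub>2 \<gamma> ^ m) y" for y
  define t' where "t' x = T_entry (\<lambda>g. cnj (q\<^sub>1 g) ^ m) (\<lambda>\<gamma>. cnj (q\<^sub>2 \<gamma>) ^ m) x" for x
  define S0 where "S0 = S (L0 (0, 0))"
  define C where "C w = S w (dual \<theta>\<^sub>1 \<theta>\<^sub>2 s Gs \<Gamma>s z) / S0 w" for w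
  have inv1: "inverse (q\<^sub>1 g) = cnj (q\<^sub>1 g)" for g
    using A.q_mult_cnj[of g] by (rule inverse_unique)
  have inv2: "inverse (q\<^sub>2 \<gamma>) = cnj (q\<^sub>2 \<gamma>)" for \<gamma>
    using B.q_mult_cnj[of \<gamma>] by (rule inverse_unique)
  have T: "(T_entry q\<^sub>1 q\<^sub>2 y / T_entry q\<^sub>1 q\<^sub>2 x) ^ m = t y * t' x" for x y
    by (cases x; cases y)
      (simp_all add: t_def t'_def q\<^sub>0_def divide_inverse inv1 inv2 power_mult_distrib)
  have "FS_indicator q\<^sub>1 \<theta>\<^sub>1 q\<^sub>2 \<theta>\<^sub>2 k\<^sub>0 \<sigma>\<^sub>0 s f Gs \<Gamma>s m z =
      (\<Sum>x\<in>J. \<Sum>y\<in>J. \<Sum>w\<in>J. (S w x * S0 x * t' x) * ((S w y * S0 y * t y) * C w))"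
    unfolding FS_indicator_def N_coeff_def N_sym_def S_entry_eq T C_def S0_def
    by (intro sum.cong refl, unfold sum_distrib_right) (intro sum.cong refl, simp)
  also have "\<dots> = (\<Sum>x\<in>J. \<Sum>w\<in>J. \<Sum>y\<in>J. (S w x * S0 x * t' x) * ((S w y * S0 y * t y) * C w))"
    by (intro sum.cong refl sum.swap)
  also have "\<dots> = (\<Sum>w\<in>J. \<Sum>x\<in>J. \<Sum>y\<in>J. (S w x * S0 x * t' x) * ((S w y * S0 y * t y) * C w))"
    by (rule sum.swap)
  also have "\<dots> = (\<Sum>w\<in>J. weight m w * S w (dual \<theta>\<^sub>1 \<theta>\<^sub>2 s Gs \<Gamma>s z))"
    unfolding weight_def t_def[symmetric] t'_def[symmetric] S0_def[symmetric]
    by (intro sum.cong refl, subst sum_product[symmetric], subst sum_distrib_right[symmetric])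
      (simp add: C_def)
  finally show ?thesis .
qed

definition nsq\<^sub>1 :: "nat \<Rightarrow> 'a \<Rightarrow> complex" where
  "nsq\<^sub>1 m h = \<tau>\<^sub>1 m h * cnj (\<tau>\<^sub>1 m h)"

definition nsq\<^sub>2 :: "nat \<Rightarrow> 'b \<Rightarrow> complex" where
  "nsq\<^sub>2 m h = \<tau>\<^sub>2 m h * cnj (\<tau>\<^sub>2 m h)"

text \<open>Twice the real part of one Gauss sum times the conjugate of the other: the mixed term in
  the squared norm of their sum.\<close>

definition cross :: "nat \<Rightarrow> 'a \<times> 'b \<Rightarrow> complex" where
  "cross m u = \<tau>\<^sub>1 m (fst u) * cnj (\<tau>\<^sub>2 m (snd u)) + cnj (\<tau>\<^sub>1 m (fst u)) * \<tau>\<^sub>2 m (snd u)"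

lemma norm_gauss_pair:
  "complex_of_real ((cmod (gauss_pair q\<^sub>1 q\<^sub>2 u m))\<^sup>2) =
    nsq\<^sub>1 m (fst u) + nsq\<^sub>2 m (snd u) + cross m u"
proof -
  have "gauss_pair q\<^sub>1 q\<^sub>2 u m = \<tau>\<^sub>1 m (fst u) + \<tau>\<^sub>2 m (snd u)"
    by (simp add: gauss_pair_def A.twisted_gauss_def B.twisted_gauss_def)
  then show ?thesis
    by (simp only: complex_norm_square nsq\<^sub>1_def nsq\<^sub>2_def cross_def) (simp add: algebra_simps)
qed

text \<open>The row sums \<open>pos\<close> for \<open>y\<close> and \<open>neg\<close> for
  \<open>x\<close> are complex conjugates of each other, so their products are squared norms; the
  minus signs of the \<open>LSigma\<close> and \<open>LGamma\<close> rows square away.\<close>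

lemma weights:
  shows "u \<in> U \<Longrightarrow> weight m (L0 u) =
      (a\<^sup>2 * nsq\<^sub>1 m (fst u) + b\<^sup>2 * nsq\<^sub>2 m (snd u) + a * b * cross m u) / (2 * (a - b))"
    and "u \<in> U \<Longrightarrow> weight m (Lpi u) =
      (a\<^sup>2 * nsq\<^sub>1 m (fst u) + b\<^sup>2 * nsq\<^sub>2 m (snd u) - a * b * cross m u) / (2 * (a + b))"
    and "k \<in> Ks \<Longrightarrow> weight m (LK k \<epsilon>) = a / 2 * nsq\<^sub>1 m k"
    and "weight m (LG g) = a * nsq\<^sub>1 m g"
    and "\<sigma> \<in> \<Sigma>s \<Longrightarrow> weight m (LSigma \<sigma> \<epsilon>) = b / 2 * nsq\<^sub>2 m \<sigma>"
    and "weight m (LGamma \<gamma>) = b * nsq\<^sub>2 m \<gamma>"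
proof -
  note pos = row_sums[where t\<^sub>1 = "\<lambda>g. q\<^sub>1 g ^ m" and t\<^sub>2 = "\<lambda>\<gamma>. q\<^sub>2 \<gamma> ^ m",
      OF _ _ _ _, simplified A.q_theta B.q_theta A.q_zero B.q_zero q_glue, OF refl refl refl TrueI,
      unfolded a_def b_def A.twisted_gauss_conv_cnj_pairing B.twisted_gauss_conv_cnj_pairing,
      folded a_def b_def]
  note neg = row_sums[where t\<^sub>1 = "\<lambda>g. cnj (q\<^sub>1 g) ^ m" and t\<^sub>2 = "\<lambda>\<gamma>. cnj (q\<^sub>2 \<gamma>) ^ m",
      OF _ _ _ _, simplified A.q_theta B.q_theta A.q_zero B.q_zero q_glue, OF refl refl refl TrueI,
      unfolded a_def b_def A.cnj_twisted_gauss B.cnj_twisted_gauss,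
      folded a_def b_def]
  have zero: "S (L0 (0, 0)) (L0 u) = (a - b) / 2" "S (L0 (0, 0)) (Lpi u) = (a + b) / 2"
    by (simp_all add: pairing_q0)
  have frac: "x / 2 * (y / 2) / (d / 2) = x * y / (2 * d)" for x y d :: complex
    by simp
  show "weight m (L0 u) =
      (a\<^sup>2 * nsq\<^sub>1 m (fst u) + b\<^sup>2 * nsq\<^sub>2 m (snd u) + a * b * cross m u) / (2 * (a - b))" if "u \<in> U"
    unfolding weight_def pos(1)[OF that] neg(1)[OF that] zero frac nsq\<^sub>1_def nsq\<^sub>2_def cross_def
    by (rule arg_cong[where f = "\<lambda>x. x / _"]) (simp add: algebra_simps power2_eq_square)
  show "weight m (Lpi u) =
      (a\<^sup>2 * nsq\<^sub>1 m (fst u) + b\<^sup>2 * nsq\<^sub>2 m (snd u) - a * b * cross m u) / (2 * (a + b))" if "u \<in> U"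
    unfolding weight_def pos(2)[OF that] neg(2)[OF that] zero frac nsq\<^sub>1_def nsq\<^sub>2_def cross_def
    by (rule arg_cong[where f = "\<lambda>x. x / _"]) (simp add: algebra_simps power2_eq_square)
  show "weight m (LK k \<epsilon>) = a / 2 * nsq\<^sub>1 m k" if "k \<in> Ks"
    unfolding weight_def pos(3)[OF that] neg(3)[OF that] nsq\<^sub>1_def by simp
  show "weight m (LG g) = a * nsq\<^sub>1 m g"
    unfolding weight_def pos(4) neg(4) nsq\<^sub>1_def by simp
  show "weight m (LSigma \<sigma> \<epsilon>) = b / 2 * nsq\<^sub>2 m \<sigma>" if "\<sigma> \<in> \<Sigma>s"
    unfolding weight_def pos(5)[OF that] neg(5)[OF that] nsq\<^sub>2_def by simp
  show "weight m (LGamma \<gamma>) = b * nsq\<^sub>2 m \<gamma>"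
    unfolding weight_def pos(6) neg(6) nsq\<^sub>2_def by simp
qed

text \<open>Weights do not depend on signs, so a column \<open>C\<close> enters only through its sum
  over both signs. This is where \<open>s\<close> and \<open>f\<close> drop out of the
  columns.\<close>

lemma sum_weight:
  "(\<Sum>w\<in>J. weight m w * C w) =
    weight m (L0 (0, 0)) * C (L0 (0, 0)) + weight m (Lpi (0, 0)) * C (Lpi (0, 0)) +
    (weight m (L0 (k\<^sub>0, \<sigma>\<^sub>0)) * C (L0 (k\<^sub>0, \<sigma>\<^sub>0)) + weight m (Lpi (k\<^sub>0, \<sigma>\<^sub>0)) * C (Lpi (k\<^sub>0, \<sigma>\<^sub>0))) +
    a / 2 * (\<Sum>k\<in>Ks. nsq\<^sub>1 m k * (C (LK k 1) + C (LK k (- 1)))) +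
    a * (\<Sum>g\<in>Gs. nsq\<^sub>1 m g * C (LG g)) +
    b / 2 * (\<Sum>\<sigma>\<in>\<Sigma>s. nsq\<^sub>2 m \<sigma> * (C (LSigma \<sigma> 1) + C (LSigma \<sigma> (- 1)))) +
    b * (\<Sum>\<gamma>\<in>\<Gamma>s. nsq\<^sub>2 m \<gamma> * C (LGamma \<gamma>))"
proof -
  have "(\<Sum>k\<in>Ks. weight m (LK k 1) * C (LK k 1) + weight m (LK k (- 1)) * C (LK k (- 1))) =
      a / 2 * (\<Sum>k\<in>Ks. nsq\<^sub>1 m k * (C (LK k 1) + C (LK k (- 1))))"
    unfolding sum_distrib_left by (intro sum.cong refl) (simp add: weights algebra_simps)
  moreover have "(\<Sum>\<sigma>\<in>\<Sigma>s. weight m (LSigma \<sigma> 1) * C (LSigma \<sigma> 1) +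
      weight m (LSigma \<sigma> (- 1)) * C (LSigma \<sigma> (- 1))) =
      b / 2 * (\<Sum>\<sigma>\<in>\<Sigma>s. nsq\<^sub>2 m \<sigma> * (C (LSigma \<sigma> 1) + C (LSigma \<sigma> (- 1))))"
    unfolding sum_distrib_left by (intro sum.cong refl) (simp add: weights algebra_simps)
  ultimately show ?thesis
    unfolding sum_labels by (simp add: weights(4,6) sum_distrib_left mult.assoc)
qed

abbreviation "gauss_norm m u \<equiv> complex_of_real ((cmod (gauss_pair q\<^sub>1 q\<^sub>2 u m))\<^sup>2)"

text \<open>One identity per kind of column: the multipliers are the entries, up to a character
  value, of the columns \<open>L0\<close>, \<open>Lpi\<close>, then \<open>LK\<close> and
  \<open>LG\<close> (up to a factor 1/2), then \<open>LSigma\<close> and \<open>LGamma\<close>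
  (likewise).\<close>

lemma weight_identities:
  assumes "u \<in> U"
  shows "weight m (L0 u) * ((a - b) / 2) + weight m (Lpi u) * ((a + b) / 2) =
      (a\<^sup>2 * nsq\<^sub>1 m (fst u) + b\<^sup>2 * nsq\<^sub>2 m (snd u)) / 2"
    and "weight m (L0 u) * ((a + b) / 2) + weight m (Lpi u) * ((a - b) / 2) =
      gauss_norm m u / 4 + (a\<^sup>2 * nsq\<^sub>1 m (fst u) - b\<^sup>2 * nsq\<^sub>2 m (snd u)) / 2"
    and "a * (weight m (L0 u) + weight m (Lpi u)) = gauss_norm m u / 4 + a\<^sup>2 * nsq\<^sub>1 m (fst u)"
    and "b * (weight m (L0 u) - weight m (Lpi u)) = gauss_norm m u / 4 - b\<^sup>2 * nsq\<^sub>2 m (snd u)"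
  unfolding weights(1,2)[OF assms] norm_gauss_pair
  by (rule mixed_norm_identities[OF ab_square a_diff_b a_plus_b])+

text \<open>In every column the entries are, up to signs and the \<open>\<epsilon>\<close>-dependent parts (which cancel because
  the weights do not depend on \<open>\<epsilon>\<close>), values of characters of the two groups. The sum over \<open>J\<close> is thereby
  completed to \<open>A\<close> resp. \<open>B\<close> times a sum over the whole group, and the remainder is supported on \<open>U\<close>.\<close>

lemma column_sum:
  fixes C :: "('a, 'b) label \<Rightarrow> complex"
  assumes U: "\<And>u. u \<in> U \<Longrightarrow> weight m (L0 u) * c + weight m (Lpi u) * c' =
      A * (a\<^sup>2 * nsq\<^sub>1 m (fst u)) + B * (b\<^sup>2 * nsq\<^sub>2 m (snd u)) + e * gauss_norm m u"
    and C0: "C (L0 (0, 0)) = c" "C (L0 (k\<^sub>0, \<sigma>\<^sub>0)) = c * x"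
    and C\<pi>: "C (Lpi (0, 0)) = c'" "C (Lpi (k\<^sub>0, \<sigma>\<^sub>0)) = c' * x"
    and CK: "\<And>k. k \<in> Ks \<Longrightarrow> C (LK k 1) + C (LK k (- 1)) = 2 * a * A * pairing q\<^sub>1 k z\<^sub>1"
    and CG: "\<And>g. C (LG g) = a * A * (pairing q\<^sub>1 g z\<^sub>1 + pairing q\<^sub>1 (\<theta>\<^sub>1 g) z\<^sub>1)"
    and C\<Sigma>: "\<And>\<sigma>. \<sigma> \<in> \<Sigma>s \<Longrightarrow> C (LSigma \<sigma> 1) + C (LSigma \<sigma> (- 1)) = 2 * b * B * pairing q\<^sub>2 \<sigma> z\<^sub>2"
    and C\<Gamma>: "\<And>\<gamma>. C (LGamma \<gamma>) = b * B * (pairing q\<^sub>2 \<gamma> z\<^sub>2 + pairing q\<^sub>2 (\<theta>\<^sub>2 \<gamma>) z\<^sub>2)"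
    and x: "A * pairing q\<^sub>1 k\<^sub>0 z\<^sub>1 = A * x" "B * pairing q\<^sub>2 \<sigma>\<^sub>0 z\<^sub>2 = B * x"
  shows "(\<Sum>w\<in>J. weight m w * C w) =
    e * (gauss_norm m (0, 0) + x * gauss_norm m (k\<^sub>0, \<sigma>\<^sub>0)) +
    A * (of_bool (nmult m z\<^sub>1 = 0) * q\<^sub>1 z\<^sub>1 ^ m) + B * (of_bool (nmult m z\<^sub>2 = 0) * q\<^sub>2 z\<^sub>2 ^ m)"
proof -
  define K where "K = (\<Sum>k\<in>Ks. nsq\<^sub>1 m k * pairing q\<^sub>1 k z\<^sub>1)"
  define N where "N = (\<Sum>\<sigma>\<in>\<Sigma>s. nsq\<^sub>2 m \<sigma> * pairing q\<^sub>2 \<sigma> z\<^sub>2)"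
  define G where "G = (\<Sum>g\<in>Gs. nsq\<^sub>1 m g * (pairing q\<^sub>1 g z\<^sub>1 + pairing q\<^sub>1 (\<theta>\<^sub>1 g) z\<^sub>1))"
  define H where "H = (\<Sum>\<gamma>\<in>\<Gamma>s. nsq\<^sub>2 m \<gamma> * (pairing q\<^sub>2 \<gamma> z\<^sub>2 + pairing q\<^sub>2 (\<theta>\<^sub>2 \<gamma>) z\<^sub>2))"
  have "(\<Sum>h\<in>UNIV. nsq\<^sub>1 m h * pairing q\<^sub>1 h z\<^sub>1) =
      nsq\<^sub>1 m 0 + nsq\<^sub>1 m k\<^sub>0 * pairing q\<^sub>1 k\<^sub>0 z\<^sub>1 + K + G"
    by (subst A.sum_orbits) (simp add: K_def G_def nsq\<^sub>1_def A.twisted_gauss_theta distrib_left)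
  moreover have "(\<Sum>h\<in>UNIV. nsq\<^sub>2 m h * pairing q\<^sub>2 h z\<^sub>2) =
      nsq\<^sub>2 m 0 + nsq\<^sub>2 m \<sigma>\<^sub>0 * pairing q\<^sub>2 \<sigma>\<^sub>0 z\<^sub>2 + N + H"
    by (subst B.sum_orbits) (simp add: N_def H_def nsq\<^sub>2_def B.twisted_gauss_theta distrib_left)
  ultimately have fourier:
    "of_bool (nmult m z\<^sub>1 = 0) * q\<^sub>1 z\<^sub>1 ^ m =
      a\<^sup>2 * (nsq\<^sub>1 m 0 + nsq\<^sub>1 m k\<^sub>0 * pairing q\<^sub>1 k\<^sub>0 z\<^sub>1 + K + G)"
    "of_bool (nmult m z\<^sub>2 = 0) * q\<^sub>2 z\<^sub>2 ^ m =
      b\<^sup>2 * (nsq\<^sub>2 m 0 + nsq\<^sub>2 m \<sigma>\<^sub>0 * pairing q\<^sub>2 \<sigma>\<^sub>0 z\<^sub>2 + N + H)"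
    using A.fourier_norm_twisted_gauss[of m z\<^sub>1] B.fourier_norm_twisted_gauss[of m z\<^sub>2]
    by (simp_all only: nsq\<^sub>1_def[symmetric] nsq\<^sub>2_def[symmetric] a_def[symmetric] b_def[symmetric])
  have "(\<Sum>k\<in>Ks. nsq\<^sub>1 m k * (C (LK k 1) + C (LK k (- 1)))) = 2 * a * A * K"
    by (simp add: CK K_def sum_distrib_left mult_ac)
  moreover have "(\<Sum>g\<in>Gs. nsq\<^sub>1 m g * C (LG g)) = a * A * G"
    by (simp add: CG G_def sum_distrib_left mult_ac)
  moreover have "(\<Sum>\<sigma>\<in>\<Sigma>s. nsq\<^sub>2 m \<sigma> * (C (LSigma \<sigma> 1) + C (LSigma \<sigma> (- 1)))) = 2 * b * B * N"
    by (simp add: C\<Sigma> N_def sum_distrib_left mult_ac)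
  moreover have "(\<Sum>\<gamma>\<in>\<Gamma>s. nsq\<^sub>2 m \<gamma> * C (LGamma \<gamma>)) = b * B * H"
    by (simp add: C\<Gamma> H_def sum_distrib_left mult_ac)
  ultimately have "(\<Sum>w\<in>J. weight m w * C w) =
      (weight m (L0 (0, 0)) * c + weight m (Lpi (0, 0)) * c') +
      x * (weight m (L0 (k\<^sub>0, \<sigma>\<^sub>0)) * c + weight m (Lpi (k\<^sub>0, \<sigma>\<^sub>0)) * c') +
      a\<^sup>2 * A * (K + G) + b\<^sup>2 * B * (N + H)"
    unfolding sum_weight C0 C\<pi> by (simp add: algebra_simps power2_eq_square)
  \<comment> \<open>Assumption \<open>U\<close> supplies exactly the terms at \<open>0\<close> and
    at \<open>k\<^sub>0\<close>, \<open>\<sigma>\<^sub>0\<close> that were missing from the group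
    sums, plus the multiple \<open>e\<close> of the norms.\<close>
  also have "\<dots> = e * (gauss_norm m (0, 0) + x * gauss_norm m (k\<^sub>0, \<sigma>\<^sub>0)) +
      a\<^sup>2 * (A * nsq\<^sub>1 m 0 + A * x * nsq\<^sub>1 m k\<^sub>0 + A * (K + G)) +
      b\<^sup>2 * (B * nsq\<^sub>2 m 0 + B * x * nsq\<^sub>2 m \<sigma>\<^sub>0 + B * (N + H))"
    using U[of "(0, 0)"] U[of "(k\<^sub>0, \<sigma>\<^sub>0)"] by (simp add: common_subgroup_def algebra_simps)
  \<comment> \<open>The value \<open>x\<close> is exchanged for a pairing only under the factor
    \<open>A\<close> or \<open>B\<close>; with coefficient 0 the element \<open>z\<^sub>1\<close> or
    \<open>z\<^sub>2\<close> can thus be a placeholder.\<close>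
  finally show ?thesis
    unfolding fourier x[symmetric] by (simp add: algebra_simps)
qed

section \<open>Indicators of the six kinds of labels\<close>

abbreviation "\<nu> \<equiv> FS_indicator q\<^sub>1 \<theta>\<^sub>1 q\<^sub>2 \<theta>\<^sub>2 k\<^sub>0 \<sigma>\<^sub>0 s f Gs \<Gamma>s"

text \<open>Both \<open>k\<^sub>0\<close> and \<open>\<sigma>\<^sub>0\<close> have order 2, so for
  nonzero \<open>u\<close> all three vanishing conditions say that \<open>m\<close> is even.\<close>

lemma U_nmult:
  assumes "u \<in> U"
  shows "nmult m (fst u) = 0 \<longleftrightarrow> nmult m u = 0" "nmult m (snd u) = 0 \<longleftrightarrow> nmult m u = 0"
    "q\<^sub>1 (fst u) = q\<^sub>0 q\<^sub>1 u" "q\<^sub>2 (snd u) = q\<^sub>0 q\<^sub>1 u"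
proof -
  have pair: "nmult m (x, y) = (nmult m x, nmult m y)" for x :: 'a and y :: 'b
    by (induction m) (simp_all add: nmult_def zero_prod_def)
  have zero: "nmult m (0 :: 'a) = 0" "nmult m (0 :: 'b) = 0"
    by (induction m) (simp_all add: nmult_def)
  show "nmult m (fst u) = 0 \<longleftrightarrow> nmult m u = 0" "nmult m (snd u) = 0 \<longleftrightarrow> nmult m u = 0"
    "q\<^sub>1 (fst u) = q\<^sub>0 q\<^sub>1 u" "q\<^sub>2 (snd u) = q\<^sub>0 q\<^sub>1 u"
    using assms
    by (auto simp: common_subgroup_def pair zero zero_prod_def A.nmult_k0 B.nmult_k0 q\<^sub>0_def q_glue
        A.k0_nonzero B.k0_nonzero split: if_splits)
qed

text \<open>Elements of \<open>U\<close> equal their negatives, so pairings with them are real. For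
  the self-dual labels over \<open>U\<close> this removes the conjugation in \<open>S\<close>; for
  other labels the negation in \<open>dual\<close> does.\<close>

lemma cnj_pairing_U:
  assumes "u \<in> U"
  shows "cnj (pairing q\<^sub>1 h (fst u)) = pairing q\<^sub>1 h (fst u)"
    and "cnj (pairing q\<^sub>2 h' (snd u)) = pairing q\<^sub>2 h' (snd u)"
    and "cnj (pairing q\<^sub>2 (snd u) h') = pairing q\<^sub>2 (snd u) h'"
proof -
  have "- k\<^sub>0 = k\<^sub>0" "- \<sigma>\<^sub>0 = \<sigma>\<^sub>0"
    using A.k0_order B.k0_order by (simp_all add: minus_unique)
  then show "cnj (pairing q\<^sub>1 h (fst u)) = pairing q\<^sub>1 h (fst u)"
    "cnj (pairing q\<^sub>2 h' (snd u)) = pairing q\<^sub>2 h' (snd u)"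
    "cnj (pairing q\<^sub>2 (snd u) h') = pairing q\<^sub>2 (snd u) h'"
    using assms A.pairing_minus_right[of h k\<^sub>0] B.pairing_minus_right[of h' \<sigma>\<^sub>0]
      B.pairing_minus_left[of \<sigma>\<^sub>0 h']
    by (auto simp: common_subgroup_def)
qed

lemma pairing_theta_fixed:
  shows "\<theta>\<^sub>1 z = z \<Longrightarrow> pairing q\<^sub>1 (\<theta>\<^sub>1 g) z = pairing q\<^sub>1 g z"
    and "\<theta>\<^sub>2 z' = z' \<Longrightarrow> pairing q\<^sub>2 (\<theta>\<^sub>2 g') z' = pairing q\<^sub>2 g' z'"
  by (simp_all add: A.pairing_theta_swap B.pairing_theta_swap)

lemmas column_simps = pairing_q0 pairing_theta_fixed
  A.pairing_minus_right B.pairing_minus_right A.theta_minus B.theta_minus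

text \<open>Both groups enter with coefficient 1/2 and no norm term remains; the two halves of the
  delta term agree on \<open>U\<close> and add up.\<close>

lemma indicator_L0:
  assumes u: "u \<in> U"
  shows "\<nu> m (L0 u) = of_bool (nmult m u = 0) * q\<^sub>0 q\<^sub>1 u ^ m"
proof -
  have "\<nu> m (L0 u) =
      0 * (gauss_norm m (0, 0) + pairing q\<^sub>1 k\<^sub>0 (fst u) * gauss_norm m (k\<^sub>0, \<sigma>\<^sub>0)) +
      1 / 2 * (of_bool (nmult m (fst u) = 0) * q\<^sub>1 (fst u) ^ m) +
      1 / 2 * (of_bool (nmult m (snd u) = 0) * q\<^sub>2 (snd u) ^ m)"
    unfolding FS_indicator_eq_weight
  proof (rule column_sum)
    show "weight m (L0 v) * ((a - b) / 2) + weight m (Lpi v) * ((a + b) / 2) =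
        1 / 2 * (a\<^sup>2 * nsq\<^sub>1 m (fst v)) + 1 / 2 * (b\<^sup>2 * nsq\<^sub>2 m (snd v)) + 0 * gauss_norm m v"
      if "v \<in> U" for v
      by (subst weight_identities(1)[OF that]) simp
  qed (use U_pairing[OF u] in \<open>simp_all add: column_simps cnj_pairing_U[OF u] U_fixed[OF u]
      A.pairing_commute[of k\<^sub>0] B.pairing_commute[of \<sigma>\<^sub>0]\<close>)
  then show ?thesis
    by (simp add: U_nmult[OF u])
qed

text \<open>The coefficients are now 1/2 and -1/2, so the delta terms cancel and only the norms
  remain.\<close>

lemma indicator_Lpi:
  assumes u: "u \<in> U"
  shows "\<nu> m (Lpi u) = 1/4 * (\<Sum>v\<in>U. pairing (q\<^sub>0 q\<^sub>1) u v * gauss_norm m v)"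
proof -
  have "\<nu> m (Lpi u) =
      1 / 4 * (gauss_norm m (0, 0) + pairing q\<^sub>1 k\<^sub>0 (fst u) * gauss_norm m (k\<^sub>0, \<sigma>\<^sub>0)) +
      1 / 2 * (of_bool (nmult m (fst u) = 0) * q\<^sub>1 (fst u) ^ m) +
      - 1 / 2 * (of_bool (nmult m (snd u) = 0) * q\<^sub>2 (snd u) ^ m)"
    unfolding FS_indicator_eq_weight
  proof (rule column_sum)
    show "weight m (L0 v) * ((a + b) / 2) + weight m (Lpi v) * ((a - b) / 2) =
        1 / 2 * (a\<^sup>2 * nsq\<^sub>1 m (fst v)) + - 1 / 2 * (b\<^sup>2 * nsq\<^sub>2 m (snd v)) + 1 / 4 * gauss_norm m v"
      if "v \<in> U" for v
      by (subst weight_identities(2)[OF that]) (simp add: diff_divide_distrib)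
  qed (use U_pairing[OF u] in \<open>simp_all add: column_simps cnj_pairing_U[OF u] U_fixed[OF u]
      A.pairing_commute[of k\<^sub>0] B.pairing_commute[of \<sigma>\<^sub>0]\<close>)
  then show ?thesis
    by (simp add: U_nmult[OF u] sum_U pairing_q0 A.pairing_commute[of k\<^sub>0])
qed

text \<open>The entries in \<open>LSigma\<close> rows cancel over the two signs and those in
  \<open>LGamma\<close> rows vanish. The second group therefore has coefficient 0, and
  \<open>0\<close> is its placeholder.\<close>

lemma indicator_LK:
  assumes k: "k \<in> Ks"
  shows "\<nu> m (LK k \<epsilon>) = 1/8 * (\<Sum>v\<in>U. pairing q\<^sub>1 k (fst v) * gauss_norm m v) +
    1/2 * of_bool (nmult m k = 0) * q\<^sub>1 k ^ m"
proof -
  have "\<nu> m (LK k \<epsilon>) =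
      1 / 8 * (gauss_norm m (0, 0) + pairing q\<^sub>1 k\<^sub>0 k * gauss_norm m (k\<^sub>0, \<sigma>\<^sub>0)) +
      1 / 2 * (of_bool (nmult m k = 0) * q\<^sub>1 k ^ m) +
      0 * (of_bool (nmult m 0 = (0 :: 'b)) * q\<^sub>2 0 ^ m)"
    unfolding FS_indicator_eq_weight
  proof (rule column_sum)
    show "weight m (L0 v) * (a / 2) + weight m (Lpi v) * (a / 2) =
        1 / 2 * (a\<^sup>2 * nsq\<^sub>1 m (fst v)) + 0 * (b\<^sup>2 * nsq\<^sub>2 m (snd v)) + 1 / 8 * gauss_norm m v"
      if "v \<in> U" for v
    proof -
      have "weight m (L0 v) * (a / 2) + weight m (Lpi v) * (a / 2) =
          a * (weight m (L0 v) + weight m (Lpi v)) / 2"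
        by (simp add: field_simps)
      then show ?thesis
        by (simp add: weight_identities(3)[OF that] field_simps)
    qed
  qed (simp_all add: column_simps A.star_fixed[OF k] field_simps)
  then show ?thesis
    by (simp add: sum_U A.pairing_commute[of k\<^sub>0])
qed

text \<open>The dual may be \<open>- g\<close> or \<open>\<theta>\<^sub>1 (- g)\<close>, but a fixed
  point pairs equally with both, and the entry in an \<open>LG\<close> row is symmetric in
  them.\<close>

lemma indicator_LG:
  "\<nu> m (LG g) = 1/4 * (\<Sum>v\<in>U. pairing q\<^sub>1 g (fst v) * gauss_norm m v) +
    of_bool (nmult m g = 0) * q\<^sub>1 g ^ m"
proof -
  have "\<nu> m (LG g) =
      1 / 4 * (gauss_norm m (0, 0) + pairing q\<^sub>1 k\<^sub>0 g * gauss_norm m (k\<^sub>0, \<sigma>\<^sub>0)) +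
      1 * (of_bool (nmult m g = 0) * q\<^sub>1 g ^ m) +
      0 * (of_bool (nmult m 0 = (0 :: 'b)) * q\<^sub>2 0 ^ m)"
    unfolding FS_indicator_eq_weight
  proof (rule column_sum)
    show "weight m (L0 v) * a + weight m (Lpi v) * a =
        1 * (a\<^sup>2 * nsq\<^sub>1 m (fst v)) + 0 * (b\<^sup>2 * nsq\<^sub>2 m (snd v)) + 1 / 4 * gauss_norm m v"
      if "v \<in> U" for v
      using weight_identities(3)[OF that, of m] by (simp add: field_simps)
  qed (simp_all add: column_simps A.star_fixed A.theta_theta A.k0_fixed A.theta_zero field_simps
      flip: A.pairing_theta_swap)
  then show ?thesis
    by (simp add: sum_U A.pairing_commute[of k\<^sub>0])
qed

lemma indicator_LSigma:
  assumes \<sigma>: "\<sigma> \<in> \<Sigma>s"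
  shows "\<nu> m (LSigma \<sigma> \<epsilon>) = 1/8 * (\<Sum>v\<in>U. pairing q\<^sub>2 \<sigma> (snd v) * gauss_norm m v) -
    1/2 * of_bool (nmult m \<sigma> = 0) * q\<^sub>2 \<sigma> ^ m"
proof -
  have "\<nu> m (LSigma \<sigma> \<epsilon>) =
      1 / 8 * (gauss_norm m (0, 0) + pairing q\<^sub>2 \<sigma>\<^sub>0 \<sigma> * gauss_norm m (k\<^sub>0, \<sigma>\<^sub>0)) +
      0 * (of_bool (nmult m 0 = (0 :: 'a)) * q\<^sub>1 0 ^ m) +
      - 1 / 2 * (of_bool (nmult m \<sigma> = 0) * q\<^sub>2 \<sigma> ^ m)"
    unfolding FS_indicator_eq_weight
  proof (rule column_sum)
    show "weight m (L0 v) * (b / 2) + weight m (Lpi v) * (- (b / 2)) =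
        0 * (a\<^sup>2 * nsq\<^sub>1 m (fst v)) + - 1 / 2 * (b\<^sup>2 * nsq\<^sub>2 m (snd v)) + 1 / 8 * gauss_norm m v"
      if "v \<in> U" for v
    proof -
      have "weight m (L0 v) * (b / 2) + weight m (Lpi v) * (- (b / 2)) =
          b * (weight m (L0 v) - weight m (Lpi v)) / 2"
        by (simp add: field_simps)
      then show ?thesis
        by (simp add: weight_identities(4)[OF that] field_simps)
    qed
  qed (simp_all add: column_simps B.star_fixed[OF \<sigma>] field_simps)
  then show ?thesis
    by (simp add: sum_U B.pairing_commute[of \<sigma>\<^sub>0])
qed

lemma indicator_LGamma:
  "\<nu> m (LGamma \<gamma>) = 1/4 * (\<Sum>v\<in>U. pairing q\<^sub>2 \<gamma> (snd v) * gauss_norm m v) -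
    of_bool (nmult m \<gamma> = 0) * q\<^sub>2 \<gamma> ^ m"
proof -
  have "\<nu> m (LGamma \<gamma>) =
      1 / 4 * (gauss_norm m (0, 0) + pairing q\<^sub>2 \<sigma>\<^sub>0 \<gamma> * gauss_norm m (k\<^sub>0, \<sigma>\<^sub>0)) +
      0 * (of_bool (nmult m 0 = (0 :: 'a)) * q\<^sub>1 0 ^ m) +
      - 1 * (of_bool (nmult m \<gamma> = 0) * q\<^sub>2 \<gamma> ^ m)"
    unfolding FS_indicator_eq_weight
  proof (rule column_sum)
    show "weight m (L0 v) * b + weight m (Lpi v) * (- b) =
        0 * (a\<^sup>2 * nsq\<^sub>1 m (fst v)) + - 1 * (b\<^sup>2 * nsq\<^sub>2 m (snd v)) + 1 / 4 * gauss_norm m v"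
      if "v \<in> U" for v
      using weight_identities(4)[OF that, of m] by (simp add: field_simps)
  qed (simp_all add: column_simps B.star_fixed B.theta_theta B.k0_fixed B.theta_zero field_simps
      flip: B.pairing_theta_swap)
  then show ?thesis
    by (simp add: sum_U B.pairing_commute[of \<sigma>\<^sub>0])
qed

end

section \<open>The indicator formulas and the consequence of (FS2)\<close>

theorem lemma5p7:
  fixes q\<^sub>1 :: "'a::{ab_group_add,finite} \<Rightarrow> complex" and \<theta>\<^sub>1 :: "'a \<Rightarrow> 'a"
    and q\<^sub>2 :: "'b::{ab_group_add,finite} \<Rightarrow> complex" and \<theta>\<^sub>2 :: "'b \<Rightarrow> 'b"
    and k\<^sub>0 k\<^sub>1 k\<^sub>2 :: 'a and \<sigma>\<^sub>0 \<sigma>\<^sub>1 \<sigma>\<^sub>2 :: 'b and c s :: complex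
    and f :: "'a \<Rightarrow> 'b \<Rightarrow> complex" and Gs :: "'a set" and \<Gamma>s :: "'b set"
  defines "Ks \<equiv> star_part \<theta>\<^sub>1 k\<^sub>0" and "\<Sigma>s \<equiv> star_part \<theta>\<^sub>2 \<sigma>\<^sub>0"
    and "U \<equiv> common_subgroup k\<^sub>0 \<sigma>\<^sub>0"
    and "\<nu> \<equiv> FS_indicator q\<^sub>1 \<theta>\<^sub>1 q\<^sub>2 \<theta>\<^sub>2 k\<^sub>0 \<sigma>\<^sub>0 s f Gs \<Gamma>s"
    and "\<G> \<equiv> \<lambda>v m. complex_of_real ((cmod (gauss_pair q\<^sub>1 q\<^sub>2 v m))\<^sup>2)"
  assumes G: "involutive_metric_group q\<^sub>1 \<theta>\<^sub>1" and \<Gamma>: "involutive_metric_group q\<^sub>2 \<theta>\<^sub>2"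
    and c: "c = gauss_sum q\<^sub>1" "c = - gauss_sum q\<^sub>2"
    and card_fixed: "card (fixed_points \<theta>\<^sub>1) = 4" "card (fixed_points \<theta>\<^sub>2) = 4"
    and k0: "k\<^sub>0 \<in> fixed_points \<theta>\<^sub>1" "k\<^sub>0 \<noteq> 0" "k\<^sub>0 + k\<^sub>0 = 0"
    and \<sigma>0: "\<sigma>\<^sub>0 \<in> fixed_points \<theta>\<^sub>2" "\<sigma>\<^sub>0 \<noteq> 0" "\<sigma>\<^sub>0 + \<sigma>\<^sub>0 = 0"
    and q_k0_\<sigma>0: "q\<^sub>1 k\<^sub>0 = q\<^sub>2 \<sigma>\<^sub>0"
    and Ks: "Ks = {k\<^sub>1, k\<^sub>2}" and \<Sigma>s: "\<Sigma>s = {\<sigma>\<^sub>1, \<sigma>\<^sub>2}"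
    and A1_A2: "(q\<^sub>1 k\<^sub>1 = q\<^sub>1 k\<^sub>2 \<and> q\<^sub>2 \<sigma>\<^sub>1 = - q\<^sub>2 \<sigma>\<^sub>2 \<and> s = c / q\<^sub>1 k\<^sub>1 \<and> s ^ 4 = 1) \<or>
                (q\<^sub>1 k\<^sub>1 = - q\<^sub>1 k\<^sub>2 \<and> q\<^sub>2 \<sigma>\<^sub>1 = q\<^sub>2 \<sigma>\<^sub>2 \<and> s = c / q\<^sub>2 \<sigma>\<^sub>1 \<and> s ^ 4 = 1)"
    and cond1: "CARD('b) = CARD('a) + 4"
    and cond2: "\<forall>k\<in>Ks. (1 + pairing q\<^sub>1 k\<^sub>0 k) * (1 - s\<^sup>2 * pairing q\<^sub>1 k k) = 0"
    and cond3: "\<forall>\<sigma>\<in>\<Sigma>s. (1 + pairing q\<^sub>2 \<sigma>\<^sub>0 \<sigma>) * (1 + s\<^sup>2 * pairing q\<^sub>2 \<sigma> \<sigma>) = 0"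
    and cond4: "iso_Z4 (fixed_points \<theta>\<^sub>1) \<longrightarrow> q\<^sub>0 q\<^sub>1 (k\<^sub>0, \<sigma>\<^sub>0) = -1"
    and cond5: "iso_Z4 (fixed_points \<theta>\<^sub>2) \<longrightarrow> q\<^sub>0 q\<^sub>1 (k\<^sub>0, \<sigma>\<^sub>0) = -1"
    and Gs: "orbit_representatives \<theta>\<^sub>1 Gs" and \<Gamma>s: "orbit_representatives \<theta>\<^sub>2 \<Gamma>s"
    and f_range: "\<forall>k\<in>Ks. \<forall>\<sigma>\<in>\<Sigma>s. f k \<sigma> \<in> {s, - s}"
    and f_k0: "\<forall>k\<in>Ks. \<forall>\<sigma>\<in>\<Sigma>s. f (k + k\<^sub>0) \<sigma> = f k \<sigma> * cnj (pairing q\<^sub>2 \<sigma>\<^sub>0 \<sigma>)"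
    and f_\<sigma>0: "\<forall>k\<in>Ks. \<forall>\<sigma>\<in>\<Sigma>s. f k (\<sigma> + \<sigma>\<^sub>0) = f k \<sigma> * cnj (pairing q\<^sub>1 k k\<^sub>0)"
  shows "(\<forall>m::nat.
           (\<forall>u\<in>U. \<nu> m (L0 u) = of_bool (nmult m u = 0) * q\<^sub>0 q\<^sub>1 u ^ m) \<and>
           (\<forall>u\<in>U. \<nu> m (Lpi u) = 1/4 * (\<Sum>v\<in>U. pairing (q\<^sub>0 q\<^sub>1) u v * \<G> v m)) \<and>
           (\<forall>k\<in>Ks. \<forall>\<epsilon>\<in>{1, -1}. \<nu> m (LK k \<epsilon>) =
             1/8 * (\<Sum>v\<in>U. pairing q\<^sub>1 k (fst v) * \<G> v m) + 1/2 * of_bool (nmult m k = 0) * q\<^sub>1 k ^ m) \<and>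
           (\<forall>g\<in>Gs. \<nu> m (LG g) =
             1/4 * (\<Sum>v\<in>U. pairing q\<^sub>1 g (fst v) * \<G> v m) + of_bool (nmult m g = 0) * q\<^sub>1 g ^ m) \<and>
           (\<forall>\<sigma>\<in>\<Sigma>s. \<forall>\<epsilon>\<in>{1, -1}. \<nu> m (LSigma \<sigma> \<epsilon>) =
             1/8 * (\<Sum>v\<in>U. pairing q\<^sub>2 \<sigma> (snd v) * \<G> v m) - 1/2 * of_bool (nmult m \<sigma> = 0) * q\<^sub>2 \<sigma> ^ m) \<and>
           (\<forall>\<gamma>\<in>\<Gamma>s. \<nu> m (LGamma \<gamma>) =
             1/4 * (\<Sum>v\<in>U. pairing q\<^sub>2 \<gamma> (snd v) * \<G> v m) - of_bool (nmult m \<gamma> = 0) * q\<^sub>2 \<gamma> ^ m)) \<and>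
         (FS2 q\<^sub>1 \<theta>\<^sub>1 q\<^sub>2 \<theta>\<^sub>2 k\<^sub>0 \<sigma>\<^sub>0 s f Gs \<Gamma>s \<longrightarrow>
           (cmod (gauss_pair q\<^sub>1 q\<^sub>2 (0, 0) 2))\<^sup>2 + (cmod (gauss_pair q\<^sub>1 q\<^sub>2 (k\<^sub>0, \<sigma>\<^sub>0) 2))\<^sup>2 = 4)"
proof -
  interpret P: orbit_metric_group_pair q\<^sub>1 \<theta>\<^sub>1 k\<^sub>0 Gs q\<^sub>2 \<theta>\<^sub>2 \<sigma>\<^sub>0 \<Gamma>s s f
  proof (intro orbit_metric_group_pair.intro orbit_metric_group.intro)
    show "orbit_metric_group_axioms \<theta>\<^sub>1 k\<^sub>0 Gs"
      using k0 Gs by (simp add: orbit_metric_group_axioms_def fixed_points_def)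
    show "orbit_metric_group_axioms \<theta>\<^sub>2 \<sigma>\<^sub>0 \<Gamma>s"
      using \<sigma>0 \<Gamma>s by (simp add: orbit_metric_group_axioms_def fixed_points_def)
  qed (use G \<Gamma> q_k0_\<sigma>0 cond1 in \<open>simp_all add: orbit_metric_group_pair_axioms_def\<close>)
  have zero: "(0, 0) \<in> U"
    by (simp add: U_def common_subgroup_def)
  have "(cmod (gauss_pair q\<^sub>1 q\<^sub>2 (0, 0) 2))\<^sup>2 + (cmod (gauss_pair q\<^sub>1 q\<^sub>2 (k\<^sub>0, \<sigma>\<^sub>0) 2))\<^sup>2 = 4"
    if fs: "FS2 q\<^sub>1 \<theta>\<^sub>1 q\<^sub>2 \<theta>\<^sub>2 k\<^sub>0 \<sigma>\<^sub>0 s f Gs \<Gamma>s"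
  proof -
    define r where "r = ((cmod (gauss_pair q\<^sub>1 q\<^sub>2 (0, 0) 2))\<^sup>2 +
      (cmod (gauss_pair q\<^sub>1 q\<^sub>2 (k\<^sub>0, \<sigma>\<^sub>0) 2))\<^sup>2) / 4"
    have "Lpi (0, 0) \<in> P.J"
      using zero by (simp add: U_def labels_def)
    then have "\<nu> 2 (Lpi (0, 0)) \<in> {1, - 1}"
      using fs unfolding FS2_def \<nu>_def by fastforce
    moreover have "\<nu> 2 (Lpi (0, 0)) = complex_of_real r"
      using P.indicator_Lpi[OF zero[unfolded U_def], of 2]
      by (simp add: \<nu>_def r_def P.sum_U P.pairing_q0)
    ultimately have "r = 1 \<or> r = - 1"
      by (metis insertE of_real_1 of_real_eq_iff of_real_minus singletonD)
    moreover have "r \<ge> 0"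
      by (simp add: r_def)
    ultimately have "r = 1"
      by linarith
    then show ?thesis
      by (simp add: r_def)
  qed
  then show ?thesis
    unfolding Ks_def \<Sigma>s_def U_def \<nu>_def \<G>_def
    using P.indicator_L0 P.indicator_Lpi P.indicator_LK P.indicator_LG P.indicator_LSigma
      P.indicator_LGamma
    by blast
qed

end
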